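(* Let $\mathbb{K}$ be a field, let $n,k,m\in\mathbb{N}$ be such that $n\geq 2$, $m\geq k\geq 3$ and $(n,k)\neq(2,3)$, let $F\in\mathcal{P}_{n,k}^{(m)}$ and let $A=A_F$. Then $$P_A\geq (1-t)^{-1}(1-nt+nt^{k-1}-t^k)^{-1},$$ where the inequality between power series in $t$ is coefficientwise.
   Context: $\mathbb{K}\langle x_1,\dots,x_n\rangle$ is the free associative unital algebra, graded by $\deg x_i=1$; $F_j$ denotes the homogeneous component of degree $j$ of $F$. $\mathbb{K}^{\rm cyc}\langle x_1,\dots,x_n\rangle$ is the subspace of cyclically invariant elements, i.e. elements fixed by the linear map sending $1\mapsto 1$ and $x_iu\mapsto ux_i$ for every monomial $u$ and every $i$; its elements are called potentials. For each $j$, the noncommutative derivative $\delta_{x_j}$ is the linear map on $\mathbb{K}\langle x_1,\dots,x_n\rangle$ with $\delta_{x_j}(x_jv)=v$ for every monomial $v$, and $\delta_{x_j}(u)=0$ for every monomial $u$ not starting with $x_j$. $\mathcal{P}_{n,k}^{(m)}=\{F\in\mathbb{K}^{\rm cyc}\langle x_1,\dots,x_n\rangle: F_j=0 \text{ for } j<k \text{ and for } j>m\}$. The potential algebra of $F$ is $A_F=\mathbb{K}\langle x_1,\dots,x_n\rangle/I$, where $I$ is the two-sided ideal generated by $\delta_{x_1}F,\dots,\delta_{x_n}F$. For $j\in\mathbb{Z}_+$, $A_F^{(j)}=\mathbb{K}\langle x_1,\dots,x_n\rangle/(I+J^{(j)})$, where $J^{(j)}$ is the ideal generated by all monomials of degree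 strictly bigger than $j$. For $A=A_F$, $P_A=\sum_{j\geq 0}\dim_{\mathbb K}\bigl(A_F^{(j)}\bigr)\,t^j$. The rational function on the right-hand side is identified with its power series expansion at $t=0$. *)

theory Defs
  imports
    "HOL-Library.Poly_Mapping"
    "HOL-Library.Cardinality"
    "HOL-Computational_Algebra.Formal_Power_Series"
    "HOL-Algebra.QuotRing"
    "HOL-Algebra.Embedded_Algebras"
begin

text \<open>
  The free monoid on \<^typ>\<open>'x\<close> is the type of lists under concatenation. The free algebra
  on the variables \<^typ>\<open>'x\<close> over \<^typ>\<open>'k\<close> is then its monoid algebra
  \<^typ>\<open>'x list \<Rightarrow>\<^sub>0 'k\<close>, with the convolution product of \<^theory>\<open>HOL-Library.Poly_Mapping\<close>.
\<close>

instantiation list :: (type) monoid_add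
begin

definition zero_list :: "'a list" where "zero_list = []"

definition plus_list :: "'a list \<Rightarrow> 'a list \<Rightarrow> 'a list" where "plus_list u v = u @ v"

instance
  by standard (simp_all add: zero_list_def plus_list_def)

end

type_synonym ('x, 'k) free_alg = "'x list \<Rightarrow>\<^sub>0 'k"

definition mon :: "'x list \<Rightarrow> ('x, 'k::field) free_alg" where
  "mon w = Poly_Mapping.single w 1"

definition scalar :: "'k \<Rightarrow> ('x, 'k::field) free_alg" where
  "scalar c = Poly_Mapping.single [] c"

lemma mon_mult: "mon u * mon v = mon (u @ v)"
  by (simp add: mon_def mult_single plus_list_def)

lemma mon_Nil: "mon [] = 1"
  by (simp add: mon_def zero_list_def[symmetric])

lemma scalar_mult_mon: "scalar c * mon w = Poly_Mapping.single w c"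
  by (simp add: scalar_def mon_def mult_single plus_list_def)

text \<open>The linear map with prescribed values on the basis of monomials.\<close>

definition lin_ext ::
    "('x list \<Rightarrow> ('x, 'k::field) free_alg) \<Rightarrow> ('x, 'k) free_alg \<Rightarrow> ('x, 'k) free_alg" where
  "lin_ext f F = (\<Sum>w\<in>Poly_Mapping.keys F. scalar (Poly_Mapping.lookup F w) * f w)"

lemma lin_ext_mon [simp]: "lin_ext f (mon w) = f w"
  by (simp add: lin_ext_def mon_def scalar_def zero_list_def[symmetric])

definition cyc_shift :: "('x, 'k::field) free_alg \<Rightarrow> ('x, 'k) free_alg" where
  "cyc_shift = lin_ext (\<lambda>w. case w of [] \<Rightarrow> 1 | x # u \<Rightarrow> mon (u @ [x]))"

definition potentials :: "('x, 'k::field) free_alg set" where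
  "potentials = {F. cyc_shift F = F}"

definition nc_deriv :: "'x \<Rightarrow> ('x, 'k::field) free_alg \<Rightarrow> ('x, 'k) free_alg" where
  "nc_deriv x = lin_ext (\<lambda>w. case w of [] \<Rightarrow> 0 | y # v \<Rightarrow> if y = x then mon v else 0)"

definition hom_comp :: "nat \<Rightarrow> ('x, 'k::field) free_alg \<Rightarrow> ('x, 'k) free_alg" where
  "hom_comp j = lin_ext (\<lambda>w. if length w = j then mon w else 0)"

definition potentials_between :: "nat \<Rightarrow> nat \<Rightarrow> ('x, 'k::field) free_alg set" where
  "potentials_between k m = {F \<in> potentials. \<forall>j. j < k \<or> j > m \<longrightarrow> hom_comp j F = 0}"

definition free_alg_ring :: "('x, 'k::field) free_alg ring" where
  "free_alg_ring = \<lparr>carrier = UNIV, mult = (*), one = 1, zero = 0, add = (+)\<rparr>"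

lemma ring_free_alg_ring: "ring (free_alg_ring :: ('x, 'k::field) free_alg ring)"
proof (rule ringI)
  show "abelian_group (free_alg_ring :: ('x, 'k) free_alg ring)"
  proof (rule abelian_groupI)
    fix F :: "('x, 'k) free_alg"
    show "\<exists>G\<in>carrier free_alg_ring. G \<oplus>\<^bsub>free_alg_ring\<^esub> F = \<zero>\<^bsub>free_alg_ring\<^esub>"
      by (rule bexI[of _ "- F"]) (simp_all add: free_alg_ring_def)
  qed (simp_all add: free_alg_ring_def add_ac)
  show "Group.monoid (free_alg_ring :: ('x, 'k) free_alg ring)"
    by (rule monoidI) (simp_all add: free_alg_ring_def mult.assoc)
qed (simp_all add: free_alg_ring_def algebra_simps)

definition potential_ideal :: "('x, 'k::field) free_alg \<Rightarrow> ('x, 'k) free_alg set" where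
  "potential_ideal F = genideal free_alg_ring (range (\<lambda>x. nc_deriv x F))"

definition high_degree_ideal :: "nat \<Rightarrow> ('x, 'k::field) free_alg set" where
  "high_degree_ideal j = genideal free_alg_ring {mon w |w. length w > j}"

definition trunc_ideal :: "('x, 'k::field) free_alg \<Rightarrow> nat \<Rightarrow> ('x, 'k) free_alg set" where
  "trunc_ideal F j = potential_ideal F <+>\<^bsub>free_alg_ring\<^esub> high_degree_ideal j"

definition trunc_algebra :: "('x, 'k::field) free_alg \<Rightarrow> nat \<Rightarrow> ('x, 'k) free_alg set ring" where
  "trunc_algebra F j = free_alg_ring Quot trunc_ideal F j"

text \<open>
  \<^const>\<open>ring.dim\<close> takes its scalars from a subfield of the ring, so the ground field enters
  as its image in the quotient. The image is a copy of the field as long as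
  \<^term>\<open>trunc_ideal F j\<close> is proper, as is the case when all terms of \<^term>\<open>F\<close> have degree at
  least 2.
\<close>

definition trunc_scalars :: "('x, 'k::field) free_alg \<Rightarrow> nat \<Rightarrow> ('x, 'k) free_alg set set" where
  "trunc_scalars F j = range (\<lambda>c. trunc_ideal F j +>\<^bsub>free_alg_ring\<^esub> scalar c)"

definition trunc_dim :: "('x, 'k::field) free_alg \<Rightarrow> nat \<Rightarrow> nat" where
  "trunc_dim F j = ring.dim (trunc_algebra F j) (trunc_scalars F j) (carrier (trunc_algebra F j))"

definition potential_series :: "('x, 'k::field) free_alg \<Rightarrow> real fps" where
  "potential_series F = Abs_fps (\<lambda>j. real (trunc_dim F j))"

definition fps_coeff_le :: "real fps \<Rightarrow> real fps \<Rightarrow> bool" where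
  "fps_coeff_le f g \<longleftrightarrow> (\<forall>j. fps_nth f j \<le> fps_nth g j)"

end

theory Submission
  imports Defs "HOL-Computational_Algebra.Polynomial"
begin

text \<open>
  Write \<open>r i = \<delta>\<^sub>i F\<close>. Modulo words longer than \<open>j\<close> the ideal of relations is the image of the
  space \<open>M\<close> with basis the symbols \<open>(u, i, v)\<close>, \<open>|u| + (k - 1) + |v| \<le> j\<close>, under
  \<open>(u, i, v) \<mapsto> u r i v\<close>, so a lower bound for the quotient follows from a lower bound for the
  kernel. For every potential the kernel contains the syzygies expressing
  \<open>\<Sum>i. x\<^sub>i r i = \<Sum>i. r i x\<^sub>i\<close> (cyclic invariance) and the trivial ones,
  where either factor of \<open>r l v r i\<close> is marked; both depend polynomially on the potential.

  In the family \<open>G + s F\<close> over \<open>K[s]\<close> the rank of these syzygies is at least their rank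
  for \<open>G\<close> (take \<open>s = 0\<close>), while the rank of the map is at least its rank for \<open>F\<close> (take
  \<open>s = \<infinity>\<close>). It therefore suffices to find one homogeneous potential \<open>G\<close> of degree \<open>k\<close> with enough
  independent syzygies. It is the sum of the rotations of the words \<open>t\<^sup>k\<^sup>-\<^sup>2 x \<pi>(x)\<close>,
  \<open>x \<noteq> t\<close>, for a letter \<open>t\<close> and an involution \<open>\<pi>\<close> of the other letters: the leading words of its
  derivatives have a single overlap, so the words avoiding them have generating function
  \<open>1 / (1 - n z + n z\<^sup>k\<^sup>-\<^sup>1 - z\<^sup>k)\<close>, and the leading symbols of the syzygies can be
  read off. The overlap condition is what fails for \<open>(n, k) = (2, 3)\<close>.
\<close>

section \<open>Linear algebra\<close>

text \<open>More vectors than coordinates are dependent. The ring is only an integral domain because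
  the coefficients will lie in \<open>K[s]\<close>; cross-multiplication with a pivot replaces
  division.\<close>

lemma nontrivial_linear_relation:
  fixes b :: "'a \<Rightarrow> 'y \<Rightarrow> 'r::idom"
  assumes "finite Y" "finite A" "card Y < card A"
  shows "\<exists>c. (\<exists>a\<in>A. c a \<noteq> 0) \<and> (\<forall>y\<in>Y. (\<Sum>a\<in>A. c a * b a y) = 0)"
  using assms
proof (induction Y arbitrary: A b rule: finite_induct)
  case empty
  then obtain a where "a \<in> A"
    by fastforce
  then show ?case
    by (intro exI[of _ "\<lambda>_. 1"]) auto
next
  case (insert y Y)
  show ?case
  proof (cases "\<forall>a\<in>A. b a y = 0")
    case True
    have "card Y < card A"
      using insert by simp
    from insert.IH[OF insert.prems(1) this, of b] True show ?thesis
      by auto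
  next
    case False
    then obtain a0 where a0: "a0 \<in> A" "b a0 y \<noteq> 0"
      by blast
    define A' where "A' = A - {a0}"
    define b' where "b' a z = b a0 y * b a z - b a y * b a0 z" for a z
    have fin: "finite A'" and "card Y < card A'"
      using insert a0 by (auto simp: A'_def)
    from insert.IH[OF this, of b'] obtain c' a1 where
      c': "a1 \<in> A'" "c' a1 \<noteq> 0" "\<And>z. z \<in> Y \<Longrightarrow> (\<Sum>a\<in>A'. c' a * b' a z) = 0"
      by blast
    \<comment> \<open>The coefficient of the pivot is chosen so that coordinate \<open>y\<close>
      cancels; the factor \<open>b a0 y\<close> on the others clears the denominator.\<close>
    define c where "c a = (if a = a0 then - (\<Sum>a\<in>A'. c' a * b a y) else b a0 y * c' a)" for a
    have sum_c: "(\<Sum>a\<in>A. c a * b a z)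
        = (\<Sum>a\<in>A'. b a0 y * c' a * b a z) - (\<Sum>a\<in>A'. c' a * b a y) * b a0 z" for z
    proof -
      have "(\<Sum>a\<in>A. c a * b a z) = c a0 * b a0 z + (\<Sum>a\<in>A'. c a * b a z)"
        unfolding A'_def using insert.prems(1) a0(1) by (rule sum.remove)
      also have "(\<Sum>a\<in>A'. c a * b a z) = (\<Sum>a\<in>A'. b a0 y * c' a * b a z)"
        by (rule sum.cong) (auto simp: c_def A'_def)
      finally show ?thesis
        by (simp add: c_def)
    qed
    have "(\<Sum>a\<in>A. c a * b a y) = 0"
      unfolding sum_c sum_distrib_right by (simp add: mult_ac)
    moreover have "(\<Sum>a\<in>A. c a * b a z) = 0" if "z \<in> Y" for z
    proof -
      have "(\<Sum>a\<in>A. c a * b a z) = (\<Sum>a\<in>A'. c' a * b' a z)"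
        unfolding sum_c b'_def right_diff_distrib sum_subtractf sum_distrib_right by (simp add: mult_ac)
      then show ?thesis
        using c'(3)[OF that] by simp
    qed
    moreover have "a1 \<in> A" "c a1 \<noteq> 0"
      using c' a0 by (auto simp: A'_def c_def)
    ultimately show ?thesis
      by (intro exI[of _ c]) auto
  qed
qed

text \<open>\<open>\<psi>\<close> is the specialisation at \<open>s = \<infinity>\<close> of \<open>\<phi> + s \<psi>\<close>, and the constant coefficients of \<open>\<sigma>\<close>
  are its specialisation at \<open>s = 0\<close>: ranks over \<open>K[s]\<close> are no smaller than these special ones.\<close>

lemma card_add_le_of_complex:
  fixes \<sigma> :: "'a \<Rightarrow> 'x \<Rightarrow> 'k::field poly" and \<phi> \<psi> :: "'x \<Rightarrow> 'y \<Rightarrow> 'k"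
  assumes fin: "finite S" "finite L" and VS: "V \<subseteq> S"
    and comp: "\<And>a y. a \<in> L \<Longrightarrow> y \<in> Y \<Longrightarrow> (\<Sum>x\<in>S. \<sigma> a x * [:\<phi> x y, \<psi> x y:]) = 0"
    and indV: "\<And>c v. (\<And>y. y \<in> Y \<Longrightarrow> (\<Sum>v\<in>V. c v * \<psi> v y) = 0) \<Longrightarrow> v \<in> V \<Longrightarrow> c v = 0"
    and indL: "\<And>c a. (\<And>x. x \<in> S \<Longrightarrow> (\<Sum>a\<in>L. c a * coeff (\<sigma> a x) 0) = 0) \<Longrightarrow> a \<in> L \<Longrightarrow> c a = 0"
  shows "card V + card L \<le> card S"
proof (rule ccontr)
  assume big: "\<not> ?thesis"
  have finV: "finite V"
    using VS fin(1) finite_subset by blast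
  \<comment> \<open>The unit vectors at \<open>V\<close> and the syzygies form one family in
    \<open>K[s]^S\<close>. If the bound fails, this family is dependent over
    \<open>K[s]\<close>.\<close>
  define b where "b z x = (case z of Inl v \<Rightarrow> of_bool (x = v) | Inr a \<Rightarrow> \<sigma> a x)"
    for z :: "'x + 'a" and x
  have "card S < card (V <+> L)"
    using big finV fin(2) by (simp add: card_Plus)
  then obtain c where c: "\<exists>z\<in>V <+> L. c z \<noteq> 0"
    "\<And>x. x \<in> S \<Longrightarrow> (\<Sum>z\<in>V <+> L. c z * b z x) = 0"
    using nontrivial_linear_relation[of S "V <+> L" b] fin finV by (metis finite_Plus)
  define q where "q v = c (Inl v)" for v
  define p where "p a = c (Inr a)" for a
  have eq: "(\<Sum>v\<in>V. q v * of_bool (x = v)) + (\<Sum>a\<in>L. p a * \<sigma> a x) = 0" if "x \<in> S" for x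
    using c(2)[OF that] finV fin(2) by (simp add: sum.Plus q_def p_def b_def)
  \<comment> \<open>Applying the map to the relation kills the syzygies and leaves a relation
    between the images of \<open>V\<close>.\<close>
  have q\<phi>: "(\<Sum>v\<in>V. q v * [:\<phi> v y, \<psi> v y:]) = 0" if y: "y \<in> Y" for y
  proof -
    have "0 = (\<Sum>x\<in>S. ((\<Sum>v\<in>V. q v * of_bool (x = v)) + (\<Sum>a\<in>L. p a * \<sigma> a x)) * [:\<phi> x y, \<psi> x y:])"
      using eq by simp
    also have "\<dots> = (\<Sum>x\<in>S. \<Sum>v\<in>V. q v * of_bool (x = v) * [:\<phi> x y, \<psi> x y:])
        + (\<Sum>x\<in>S. \<Sum>a\<in>L. p a * (\<sigma> a x * [:\<phi> x y, \<psi> x y:]))"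
      by (simp only: distrib_right sum_distrib_right sum.distrib mult.assoc)
    also have "(\<Sum>x\<in>S. \<Sum>a\<in>L. p a * (\<sigma> a x * [:\<phi> x y, \<psi> x y:])) = 0"
      by (subst sum.swap) (simp add: sum_distrib_left[symmetric] comp y del: mult_pCons_right)
    also have "(\<Sum>x\<in>S. \<Sum>v\<in>V. q v * of_bool (x = v) * [:\<phi> x y, \<psi> x y:])
        = (\<Sum>v\<in>V. \<Sum>x\<in>S. if x = v then q v * [:\<phi> x y, \<psi> x y:] else 0)"
      by (subst sum.swap) (auto intro!: sum.cong)
    also have "\<dots> = (\<Sum>v\<in>V. q v * [:\<phi> v y, \<psi> v y:])"
      using VS fin(1) by (intro sum.cong) auto
    finally show ?thesis
      by simp
  qed
  have q0: "q v = 0" if v: "v \<in> V" for v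
  proof -
    \<comment> \<open>With \<open>N\<close> the largest degree among the \<open>q v\<close>, the
      coefficient of \<open>s^(N+1)\<close> sees only \<open>\<psi>\<close>, so independence at
      infinity kills all top coefficients.\<close>
    define N where "N = Max ((\<lambda>v. degree (q v)) ` V)"
    have deg: "degree (q w) \<le> N" if "w \<in> V" for w
      unfolding N_def using that finV by auto
    have top: "coeff (q w) N = 0" if "w \<in> V" for w
    proof (rule indV[OF _ that])
      fix y assume y: "y \<in> Y"
      have "0 = coeff (\<Sum>v\<in>V. q v * [:\<phi> v y, \<psi> v y:]) (Suc N)"
        unfolding q\<phi>[OF y] by simp
      also have "\<dots> = (\<Sum>v\<in>V. coeff (q v) N * \<psi> v y)"
        unfolding coeff_sum
      proof (rule sum.cong[OF refl])
        fix w assume "w \<in> V"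
        then have "coeff (q w) (Suc N) = 0"
          using deg[of w] by (intro coeff_eq_0) simp
        then show "coeff (q w * [:\<phi> w y, \<psi> w y:]) (Suc N) = coeff (q w) N * \<psi> w y"
          by simp
      qed
      finally show "(\<Sum>v\<in>V. coeff (q v) N * \<psi> v y) = 0"
        by simp
    qed
    have "N \<in> (\<lambda>v. degree (q v)) ` V"
      unfolding N_def using finV v by (intro Max_in) auto
    then obtain w where w: "w \<in> V" "degree (q w) = N"
      by auto
    then have "q w = 0"
      using top[of w] by (metis leading_coeff_0_iff)
    then have "N = 0"
      using w by simp
    then show ?thesis
      using deg[OF v] top[OF v] by (metis le_zero_eq leading_coeff_0_iff)
  qed
  have p\<sigma>: "(\<Sum>a\<in>L. p a * \<sigma> a x) = 0" if "x \<in> S" for x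
    using eq[OF that] q0 by simp
  \<comment> \<open>Dually, from the bottom: once the coefficients below \<open>e\<close> vanish,
    the coefficient of \<open>s^e\<close> sees the syzygies only at \<open>s = 0\<close>.\<close>
  have p0: "coeff (p a) e = 0" if "a \<in> L" for a e
    using that
  proof (induction e arbitrary: a rule: less_induct)
    case (less e)
    show ?case
    proof (rule indL[of "\<lambda>a. coeff (p a) e", OF _ less.prems])
      fix x assume x: "x \<in> S"
      have "coeff (p a * \<sigma> a x) e = coeff (p a) e * coeff (\<sigma> a x) 0" if "a \<in> L" for a
      proof -
        have "coeff (p a * \<sigma> a x) e = (\<Sum>i\<in>{e}. coeff (p a) i * coeff (\<sigma> a x) (e - i))"
          unfolding coeff_mult using less.IH that by (intro sum.mono_neutral_right) auto
        then show ?thesis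
          by simp
      qed
      then have "(\<Sum>a\<in>L. coeff (p a) e * coeff (\<sigma> a x) 0) = coeff (\<Sum>a\<in>L. p a * \<sigma> a x) e"
        by (simp add: coeff_sum)
      then show "(\<Sum>a\<in>L. coeff (p a) e * coeff (\<sigma> a x) 0) = 0"
        using p\<sigma>[OF x] by simp
    qed
  qed
  have "p a = 0" if "a \<in> L" for a
    using p0[OF that] by (intro poly_eqI) simp
  with q0 c(1) show False
    by (auto simp: p_def q_def)
qed

text \<open>At the element \<open>m\<close> of the support with largest \<open>ord\<close>, no other
  member of the support contributes, so \<open>c m * \<tau> m m = 0\<close>. Ties in
  \<open>ord\<close> are harmless because off-diagonal entries require a strict decrease.\<close>

lemma triangular_independent:
  fixes \<tau> :: "'x \<Rightarrow> 'x \<Rightarrow> 'k::idom" and ord :: "'x \<Rightarrow> nat"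
  assumes "finite L" and diag: "\<And>a. a \<in> L \<Longrightarrow> \<tau> a a \<noteq> 0"
    and tri: "\<And>a x. a \<in> L \<Longrightarrow> x \<in> L \<Longrightarrow> \<tau> a x \<noteq> 0 \<Longrightarrow> x = a \<or> ord x < ord a"
    and rel: "\<And>x. x \<in> L \<Longrightarrow> (\<Sum>a\<in>L. c a * \<tau> a x) = 0"
    and "a \<in> L"
  shows "c a = 0"
proof (rule ccontr)
  assume "c a \<noteq> 0"
  define P where "P = {a \<in> L. c a \<noteq> 0}"
  have P: "finite P" "P \<noteq> {}"
    using \<open>finite L\<close> \<open>c a \<noteq> 0\<close> \<open>a \<in> L\<close> by (auto simp: P_def)
  obtain m where m: "m \<in> P" "\<And>x. x \<in> P \<Longrightarrow> ord x \<le> ord m"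
  proof -
    have "Max (ord ` P) \<in> ord ` P"
      using P by (intro Max_in) auto
    then obtain m where "m \<in> P" "ord m = Max (ord ` P)"
      by auto
    then show thesis
      using that[of m] P by simp
  qed
  have "c x * \<tau> x m = 0" if "x \<in> L - {m}" for x
    using that m tri[of x m] by (force simp: P_def)
  then have "(\<Sum>a\<in>L - {m}. c a * \<tau> a m) = 0"
    by (rule sum.neutral[rule_format])
  then have "(\<Sum>a\<in>L. c a * \<tau> a m) = c m * \<tau> m m"
    using m(1) \<open>finite L\<close> by (subst sum.remove[of _ m]) (auto simp: P_def)
  then show False
    using rel[of m] m(1) diag[of m] by (auto simp: P_def)
qed

section \<open>Words avoiding the leading words\<close>

lemma finite_short_words: "finite {m :: 'x::finite list. length m \<le> j}"
  using finite_lists_length_le[of "UNIV :: 'x set" j] by simp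

text \<open>For \<open>k = 3\<close> the word \<open>[b, \<pi> b]\<close> would overlap itself if
  \<open>\<pi> b = b\<close>. An involution that fixes \<open>t\<close> and moves \<open>b\<close>
  needs a third letter.\<close>

locale leading_words =
  fixes t b :: "'x::finite" and \<pi> :: "'x \<Rightarrow> 'x" and k :: nat
  assumes k3: "3 \<le> k" and b_neq: "b \<noteq> t"
    and \<pi>_invol [simp]: "\<pi> (\<pi> x) = x" and \<pi>_t [simp]: "\<pi> t = t"
    and \<pi>_b: "k = 3 \<Longrightarrow> \<pi> b \<noteq> b"
begin

lemma \<pi>_eq_t [simp]: "\<pi> x = t \<longleftrightarrow> x = t"
  by (metis \<pi>_invol \<pi>_t)

lemma \<pi>_inj [simp]: "\<pi> x = \<pi> y \<longleftrightarrow> x = y"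
  by (metis \<pi>_invol)

text \<open>The lexicographically largest words in the derivatives of \<open>G\<close>, for \<open>t\<close> the largest letter,
  followed by \<open>b\<close>.\<close>

definition lw :: "'x \<Rightarrow> 'x list" where
  "lw i = (if i = t then replicate (k - 3) t @ [b, \<pi> b] else replicate (k - 2) t @ [\<pi> i])"

definition normal :: "'x list \<Rightarrow> bool" where
  "normal u \<longleftrightarrow> (\<nexists>p i q. u = p @ lw i @ q)"

text \<open>Behind a prefix ending in \<open>t\<close>, the word \<open>lw t\<close> is overlapped
  from the left by \<open>lw (\<pi> b)\<close>; this is the situation to be excluded.\<close>

definition ends_t :: "'x list \<Rightarrow> bool" where
  "ends_t u \<longleftrightarrow> u \<noteq> [] \<and> last u = t"

lemma length_lw [simp]: "length (lw i) = k - 1"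
  using k3 by (auto simp: lw_def)

lemma lw_neq_Nil [simp]: "lw i \<noteq> []"
  by (auto simp: lw_def)

lemma lw_nth_less: "p < k - 3 \<Longrightarrow> lw i ! p = t"
  by (auto simp: lw_def nth_append)

lemma lw_nth_penult: "lw i ! (k - 3) = (if i = t then b else t)"
  using k3 by (auto simp: lw_def nth_append)

lemma lw_nth_last: "lw i ! (k - 2) = \<pi> (if i = t then b else i)"
proof -
  obtain m where m: "k = m + 3"
    using k3 by (metis add.commute le_Suc_ex)
  show ?thesis
    unfolding lw_def by (simp add: m nth_append)
qed

lemma lw_nth_last_neq: "lw i ! (k - 2) \<noteq> t"
  using b_neq by (simp add: lw_nth_last)

lemma last_lw: "last (lw i) \<noteq> t"
  using b_neq by (simp add: lw_def)

lemma lw_inj: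
  assumes "lw i = lw l"
  shows "i = l"
proof -
  have "(if i = t then b else t) = (if l = t then b else t)"
    unfolding lw_nth_penult[symmetric] assms ..
  then have "(i = t) = (l = t)"
    using b_neq by (simp split: if_splits)
  moreover have "\<pi> (if i = t then b else i) = \<pi> (if l = t then b else l)"
    unfolding lw_nth_last[symmetric] assms ..
  then have "(if i = t then b else i) = (if l = t then b else l)"
    by (simp only: \<pi>_inj)
  ultimately show ?thesis
    by (cases "i = t") simp_all
qed

lemma normal_Nil [simp]: "normal []"
  by (auto simp: normal_def)

lemma normal_prefix:
  assumes "normal (u @ v)"
  shows "normal u"
  unfolding normal_def
proof safe
  fix p i q assume "u = p @ lw i @ q"
  then have "u @ v = p @ lw i @ (q @ v)"
    by simp
  then show False
    using assms unfolding normal_def by blast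
qed

lemma not_normal_lw: "\<not> normal (p @ lw i @ q)"
  by (auto simp: normal_def)

text \<open>No leading word ends in \<open>t\<close>. Hence normal words of length \<open>d\<close>
  ending in \<open>t\<close> correspond to all normal words of length \<open>d - 1\<close>.\<close>

lemma normal_snoc_t [simp]: "normal (u @ [t]) \<longleftrightarrow> normal u"
proof
  assume u: "normal u"
  show "normal (u @ [t])"
    unfolding normal_def
  proof safe
    fix p i q assume *: "u @ [t] = p @ lw i @ q"
    show False
    proof (cases q rule: rev_cases)
      case Nil
      then have "last (lw i) = t"
        using * by (metis append_Nil2 last_appendR last_snoc lw_neq_Nil)
      then show ?thesis
        using last_lw by simp
    next
      case (snoc q' x)
      then have "u = p @ lw i @ q'"
        using * by simp
      then show ?thesis
        using u not_normal_lw by simp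
    qed
  qed
qed (rule normal_prefix)

text \<open>The only overlap of two leading words is \<open>t # lw t = lw (\<pi> b) @ [\<pi> b]\<close>.\<close>

lemma lw_overlap:
  assumes "normal u" "i = t \<longrightarrow> \<not> ends_t u" and eq: "u @ lw i = p @ lw l @ q"
  shows "length u \<le> length p"
proof (rule ccontr)
  assume less: "\<not> ?thesis"
  \<comment> \<open>\<open>d\<close> is the distance by which the supposed occurrence of
    \<open>lw l\<close> starts to the left of \<open>lw i\<close>.\<close>
  define d where "d = length u - length p"
  have q: "length q = d"
    using arg_cong[OF eq, of length] by (simp add: d_def)
  have d: "0 < d"
    using less by (simp add: d_def)
  have nth_l: "(u @ lw i) ! (length p + s) = lw l ! s" if "s < k - 1" for s
    unfolding eq using that by (simp add: nth_append)
  have nth_i: "(u @ lw i) ! (length u + s) = lw i ! s" for s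
    by (simp add: nth_append)
  show False
  proof (cases "k - 1 \<le> d")
    case True
    have "u = take (length u) (p @ lw l @ q)"
      unfolding eq[symmetric] by simp
    also have "\<dots> = p @ lw l @ take (length u - length p - (k - 1)) q"
      using less True by (simp add: d_def)
    finally show False
      using assms(1) not_normal_lw by metis
  next
    case False
    have shift: "lw l ! (d + s) = lw i ! s" if "d + s < k - 1" for s
      using nth_l[OF that] nth_i[of s] less by (simp add: d_def)
    \<comment> \<open>The last letter of \<open>lw l\<close> is not \<open>t\<close>, and in
      \<open>lw i\<close> only the last two positions can differ from \<open>t\<close>. As
      \<open>d > 0\<close>, it falls on the penultimate one, which forces \<open>d = 1\<close> and
      \<open>i = t\<close>.\<close>
    have "lw i ! (k - 2 - d) = lw l ! (k - 2)"
      using shift[of "k - 2 - d"] False d k3 by simp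
    then have nt: "lw i ! (k - 2 - d) \<noteq> t"
      using lw_nth_last_neq by simp
    moreover from this have "\<not> k - 2 - d < k - 3"
      using lw_nth_less by metis
    ultimately have kd: "k - 2 - d = k - 3"
      using d k3 False by linarith
    then have d1: "d = 1"
      using d k3 False by linarith
    have "lw i ! (k - 3) \<noteq> t"
      using nt unfolding kd .
    then have it: "i = t"
      using lw_nth_penult[of i] by (auto split: if_splits)
    \<comment> \<open>Now \<open>lw l\<close> begins with the last letter of \<open>u\<close>, which
      is not \<open>t\<close>. A leading word beginning with another letter than \<open>t\<close>
      exists only for \<open>k = 3\<close>, and it is \<open>lw t\<close>.\<close>
    have "l = t" "k = 3"
    proof -
      have "u = take (length u) (p @ lw l @ q)"
        unfolding eq[symmetric] by simp
      also have "\<dots> = p @ [lw l ! 0]"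
        using d1 less k3 by (cases "lw l") (auto simp: d_def Suc_diff_Suc)
      finally have "last u = lw l ! 0" "u \<noteq> []"
        by (metis last_snoc, simp)
      then have "lw l ! 0 \<noteq> t"
        using assms(2) it by (auto simp: ends_t_def)
      then have "\<not> 0 < k - 3"
        using lw_nth_less by metis
      then show "k = 3"
        using k3 by simp
      then show "l = t"
        using \<open>lw l ! 0 \<noteq> t\<close> lw_nth_penult[of l] by (auto split: if_splits)
    qed
    then show False
      using shift[of 0] d1 lw_nth_last[of t] lw_nth_penult[of t] it \<pi>_b by simp
  qed
qed

text \<open>By \<open>lw_overlap\<close> the marked factor is the leftmost leading word in the whole
  word, so the word determines it.\<close>

lemma lw_factor_unique:
  assumes "normal u" "i = t \<longrightarrow> \<not> ends_t u" "normal u'" "i' = t \<longrightarrow> \<not> ends_t u'"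
    and eq: "u @ lw i @ v = u' @ lw i' @ v'"
  shows "u = u' \<and> i = i' \<and> v = v'"
proof -
  have le: "length u' \<le> length u"
    if "normal u'" "i' = t \<longrightarrow> \<not> ends_t u'" and eq: "u @ lw i @ v = u' @ lw i' @ v'"
    for u i v u' i' v'
  proof (rule ccontr)
    assume less: "\<not> ?thesis"
    have "u' @ lw i' = take (length u' + (k - 1)) (u @ lw i @ v)"
      unfolding eq by simp
    also have "\<dots> = u @ lw i @ take (length u' - length u) v"
      using less by simp
    finally show False
      using lw_overlap[OF that(1,2)] less by blast
  qed
  have "length u = length u'"
    using le[OF assms(1,2) eq[symmetric]] le[OF assms(3,4) eq] by simp
  then have "u = u' \<and> lw i @ v = lw i' @ v'"
    using eq append_eq_append_conv[of u u'] by blast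
  moreover from this have "lw i = lw i' \<and> v = v'"
    using append_eq_append_conv[of "lw i" "lw i'" v v'] by simp
  ultimately show ?thesis
    using lw_inj by blast
qed

section \<open>Counting normal words\<close>

definition normal_words :: "nat \<Rightarrow> 'x list set" where
  "normal_words d = {u. length u = d \<and> normal u}"

text \<open>The words \<open>u @ lw i\<close> for these pairs are exactly those that first fail to
  be normal at their last letter.\<close>

definition ext_words :: "nat \<Rightarrow> ('x list \<times> 'x) set" where
  "ext_words d = {(u, i). u \<in> normal_words d \<and> (i = t \<longrightarrow> \<not> ends_t u)}"

lemma finite_words: "finite {u :: 'x list. length u = d}"
  using finite_lists_length_eq[of "UNIV :: 'x set" d] by simp

lemma finite_normal_words: "finite (normal_words d)"
  by (rule finite_subset[OF _ finite_words[of d]]) (auto simp: normal_words_def)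

lemma finite_ext_words: "finite (ext_words d)"
proof (rule finite_subset)
  show "ext_words d \<subseteq> normal_words d \<times> UNIV"
    by (auto simp: ext_words_def)
qed (simp add: finite_normal_words)

text \<open>The pairs left out are \<open>(u @ [t], t)\<close> with \<open>u\<close> normal of
  length \<open>d - 1\<close>; there are none for \<open>d = 0\<close>.\<close>

lemma card_ext_words:
  "card (ext_words d) + (if d = 0 then 0 else card (normal_words (d - 1)))
    = CARD('x) * card (normal_words d)"
proof -
  define B where "B = {(u, i). u \<in> normal_words d \<and> i = t \<and> ends_t u}"
  have "B = (if d = 0 then {} else (\<lambda>u. (u @ [t], t)) ` normal_words (d - 1))"
  proof (cases d)
    case 0
    then show ?thesis
      by (auto simp: B_def ends_t_def normal_words_def)
  next
    case (Suc e)
    have "x \<in> (\<lambda>u. (u @ [t], t)) ` normal_words e" if x: "x \<in> B" for x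
    proof -
      obtain u where u: "x = (u, t)" "length u = Suc e" "normal u" "ends_t u"
        using x unfolding Suc B_def normal_words_def by blast
      then obtain w where w: "u = w @ [t]"
        unfolding ends_t_def by (metis append_butlast_last_id)
      then have "w \<in> normal_words e"
        using u by (simp add: normal_words_def)
      then show ?thesis
        unfolding u(1) w by (rule imageI)
    qed
    moreover have "(\<lambda>u. (u @ [t], t)) ` normal_words e \<subseteq> B"
      using Suc by (auto simp: B_def ends_t_def normal_words_def)
    ultimately show ?thesis
      using Suc by auto
  qed
  then have cB: "card B = (if d = 0 then 0 else card (normal_words (d - 1)))"
    by (simp add: card_image inj_on_def)
  have fB: "finite B"
    by (rule finite_subset[of _ "normal_words d \<times> UNIV"]) (auto simp: B_def finite_normal_words)
  have "ext_words d \<union> B = normal_words d \<times> UNIV" "ext_words d \<inter> B = {}"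
    by (auto simp: ext_words_def B_def)
  then have "card (ext_words d) + card B = card (normal_words d \<times> (UNIV :: 'x set))"
    using finite_ext_words fB by (metis card_Un_disjoint)
  then show ?thesis
    using cB by (simp add: card_cartesian_product mult.commute)
qed

text \<open>Appending a letter to a normal word gives either a normal word or some
  \<open>u @ lw i\<close> with \<open>(u, i)\<close> in \<open>ext_words\<close>. Since
  \<open>lw i\<close> has length \<open>k - 1\<close>, the prefix has length
  \<open>d + 1 - (k - 1)\<close>; the guard protects the truncated subtraction.\<close>

lemma card_normal_words_Suc:
  "CARD('x) * card (normal_words d)
    = card (normal_words (Suc d)) + (if k - 2 \<le> d then card (ext_words (d - (k - 2))) else 0)"
proof -
  define W where "W = (\<lambda>(u, x). u @ [x]) ` (normal_words d \<times> (UNIV :: 'x set))"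
  define E where "E = (if k - 2 \<le> d then (\<lambda>(u, i). u @ lw i) ` ext_words (d - (k - 2)) else {})"
  have fW: "finite W"
    unfolding W_def using finite_normal_words by simp
  have cW: "card W = CARD('x) * card (normal_words d)"
    unfolding W_def by (subst card_image) (auto simp: inj_on_def card_cartesian_product)
  have cE: "card E = (if k - 2 \<le> d then card (ext_words (d - (k - 2))) else 0)"
  proof (cases "k - 2 \<le> d")
    case True
    have "inj_on (\<lambda>(u, i). u @ lw i) (ext_words (d - (k - 2)))"
      by (auto simp: inj_on_def ext_words_def normal_words_def intro: lw_inj)
    then show ?thesis
      using True by (simp add: E_def card_image)
  qed (simp add: E_def)
  have un: "W = normal_words (Suc d) \<union> E"
  proof
    show "W \<subseteq> normal_words (Suc d) \<union> E"
    proof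
      fix z assume "z \<in> W"
      then obtain u x where z: "z = u @ [x]" "length u = d" "normal u"
        by (auto simp: W_def normal_words_def)
      show "z \<in> normal_words (Suc d) \<union> E"
      proof (cases "normal z")
        case False
        then obtain p i q where pq: "z = p @ lw i @ q"
          by (auto simp: normal_def)
        have q: "q = []"
        proof (cases q rule: rev_cases)
          case (snoc q' y)
          then have "u = p @ lw i @ q'"
            using pq z by simp
          then show ?thesis
            using z not_normal_lw by simp
        qed
        have len: "length p + (k - 1) = Suc d"
          using arg_cong[OF pq, of length] z q by simp
        have u: "u = p @ butlast (lw i)"
          using pq q z by (metis append_Nil2 butlast_append butlast_snoc lw_neq_Nil)
        then have np: "normal p"
          using z normal_prefix by blast
        \<comment> \<open>Otherwise the final \<open>t\<close> of \<open>p\<close>, followed by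
          \<open>lw t\<close> without its last letter, would be the word \<open>lw (\<pi> b)\<close>
          inside the normal word \<open>u\<close>.\<close>
        have "\<not> ends_t p" if "i = t"
        proof
          assume "ends_t p"
          then obtain p' where "p = p' @ [t]"
            unfolding ends_t_def by (metis append_butlast_last_id)
          moreover have "t # butlast (lw t) = lw (\<pi> b)"
          proof (cases "k = 3")
            case False
            then have "k - 2 = Suc (k - 3)"
              using k3 by simp
            then show ?thesis
              using b_neq by (simp add: lw_def butlast_append)
          next
            case True
            show ?thesis
              unfolding lw_def using b_neq by (simp add: True numeral_eq_Suc)
          qed
          ultimately have "u = p' @ lw (\<pi> b) @ []"
            using u that by simp
          then show False
            using z not_normal_lw by metis
        qed
        moreover have "length p = d - (k - 2)" "k - 2 \<le> d"
          using len k3 by auto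
        ultimately have "z \<in> E"
          using np pq q by (auto simp: E_def ext_words_def normal_words_def)
        then show ?thesis
          by simp
      qed (use z in \<open>simp add: normal_words_def\<close>)
    qed
  next
    have "normal_words (Suc d) \<subseteq> W"
    proof
      fix z assume z: "z \<in> normal_words (Suc d)"
      then obtain u x where "z = u @ [x]"
        by (cases z rule: rev_cases) (auto simp: normal_words_def)
      with z show "z \<in> W"
        by (auto simp: W_def normal_words_def dest: normal_prefix)
    qed
    moreover have "E \<subseteq> W"
    proof
      fix z assume z: "z \<in> E"
      then have kd: "k - 2 \<le> d"
        by (auto simp: E_def split: if_splits)
      then obtain u i where ui: "z = u @ lw i" "length u = d - (k - 2)" "normal u"
        "i = t \<longrightarrow> \<not> ends_t u"
        using z by (auto simp: E_def ext_words_def normal_words_def)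
      \<comment> \<open>By \<open>lw_overlap\<close> a leading word cannot start before position
        \<open>length u\<close>, and from there only \<open>k - 2\<close> letters remain.\<close>
      have "normal (u @ butlast (lw i))"
        unfolding normal_def
      proof safe
        fix p l q assume *: "u @ butlast (lw i) = p @ lw l @ q"
        have "u @ lw i = (u @ butlast (lw i)) @ [last (lw i)]"
          by simp
        also have "\<dots> = p @ lw l @ (q @ [last (lw i)])"
          unfolding * by simp
        finally have "length u \<le> length p"
          using lw_overlap ui(3,4) by blast
        then show False
          using arg_cong[OF *, of length] k3 by simp
      qed
      moreover have "z = (u @ butlast (lw i)) @ [last (lw i)]"
        using ui by simp
      moreover have "length (u @ butlast (lw i)) = d"
        using ui kd k3 by simp
      ultimately show "z \<in> W"
        unfolding W_def normal_words_def by (intro image_eqI[of _ _ "(u @ butlast (lw i), last (lw i))"]) auto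
    qed
    ultimately show "normal_words (Suc d) \<union> E \<subseteq> W"
      by blast
  qed
  have dis: "normal_words (Suc d) \<inter> E = {}"
  proof -
    have "\<not> normal z" if "z \<in> E" for z
    proof -
      have "z \<in> (\<lambda>(u, i). u @ lw i) ` ext_words (d - (k - 2))"
        using that by (simp add: E_def split: if_splits)
      then obtain x where "z = (\<lambda>(u, i). u @ lw i) x"
        by blast
      then have "z = fst x @ lw (snd x) @ []"
        by (simp add: case_prod_beta)
      then show ?thesis
        using not_normal_lw by metis
    qed
    then show ?thesis
      by (auto simp: normal_words_def)
  qed
  have "card W = card (normal_words (Suc d)) + card E"
    unfolding un using fW un dis by (intro card_Un_disjoint) simp_all
  then show ?thesis
    unfolding cW cE .
qed

lemma normal_words_0: "card (normal_words 0) = 1"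
proof -
  have "normal_words 0 = {[]}"
    by (auto simp: normal_words_def)
  then show ?thesis
    by simp
qed

text \<open>Eliminating \<open>ext_words\<close> from the two counts gives
  \<open>N (d+1) = n N d - n N (d-k+2) + N (d-k+1)\<close>, the recursion belonging to this
  denominator.\<close>

lemma fps_normal_words:
  defines "n \<equiv> CARD('x)"
  shows "Abs_fps (\<lambda>d. real (card (normal_words d)))
    * (1 - of_nat n * fps_X + of_nat n * fps_X ^ (k - 1) - fps_X ^ k) = 1"
proof (rule fps_ext)
  define N where "N d = real (card (normal_words d))" for d
  have rec: "N (Suc d) = n * N d
      - (if k - 2 \<le> d then n * N (d - (k - 2)) - (if d = k - 2 then 0 else N (d - (k - 1))) else 0)" for d
  proof -
    have "real (n * card (normal_words d)) = real (card (normal_words (Suc d))) +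
        (if k - 2 \<le> d then real (card (ext_words (d - (k - 2)))) else 0)"
      using card_normal_words_Suc[of d] by (simp add: n_def)
    moreover have "real (card (ext_words (d - (k - 2)))) =
        n * N (d - (k - 2)) - (if d = k - 2 then 0 else N (d - (k - 1)))" if "k - 2 \<le> d"
    proof -
      have "d - (k - 2) - 1 = d - (k - 1)"
        using k3 by simp
      then show ?thesis
        using card_ext_words[of "d - (k - 2)", THEN arg_cong, of real] that
        by (auto simp: n_def N_def)
    qed
    ultimately show ?thesis
      by (auto simp: N_def)
  qed
  fix d
  have "fps_nth (Abs_fps N * (1 - of_nat n * fps_X + of_nat n * fps_X ^ (k - 1) - fps_X ^ k)) d
     = N d - (if d = 0 then 0 else n * N (d - 1)) + (if d < k - 1 then 0 else n * N (d - (k - 1)))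
        - (if d < k then 0 else N (d - k))"
    by (simp add: ring_distribs mult.left_commute[of _ "of_nat n"] fps_X_power_mult_right_nth) arith
  also have "\<dots> = fps_nth 1 d"
  proof (cases d)
    case 0
    then show ?thesis
      using k3 normal_words_0 by (simp add: N_def)
  next
    case (Suc e)
    then show ?thesis
      using rec[of e] k3 by (auto simp: Suc_diff_le)
  qed
  finally show "fps_nth (Abs_fps (\<lambda>d. real (card (normal_words d)))
    * (1 - of_nat n * fps_X + of_nat n * fps_X ^ (k - 1) - fps_X ^ k)) d = fps_nth 1 d"
    unfolding N_def[abs_def] .
qed

text \<open>The factor \<open>1 / (1 - z)\<close> forms partial sums, so the bound to be proved
  becomes a count of normal words of length at most \<open>j\<close>.\<close>

lemma nth_hilbert_series:
  "fps_nth (inverse (1 - fps_X) *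
     inverse (1 - of_nat CARD('x) * fps_X + of_nat CARD('x) * fps_X ^ (k - 1) - fps_X ^ k)) j
   = real (\<Sum>d\<le>j. card (normal_words d))"
proof -
  define D :: "real fps" where
    "D = 1 - of_nat CARD('x) * fps_X + of_nat CARD('x) * fps_X ^ (k - 1) - fps_X ^ k"
  define N where "N = Abs_fps (\<lambda>d. real (card (normal_words d)))"
  have "D * N = 1"
    using fps_normal_words by (simp add: D_def N_def mult.commute)
  moreover from this have "fps_nth D 0 \<noteq> 0"
    by (metis fps_mult_nth_0 fps_one_nth mult_zero_left zero_neq_one)
  ultimately have "inverse D = N"
    by (intro fps_inverse_unique)
  moreover have "inverse (1 - fps_X) = Abs_fps (\<lambda>_. 1 :: real)"
    by (rule fps_inverse_unique) (rule fps_ext, simp add: algebra_simps)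
  ultimately show ?thesis
    unfolding D_def[symmetric]
    by (subst mult.commute) (simp add: fps_mult_nth N_def atMost_atLeast0)
qed

text \<open>The symbols that are not leading symbols of syzygies.\<close>

definition normal_symbols :: "nat \<Rightarrow> ('x list \<times> 'x \<times> 'x list) set" where
  "normal_symbols j = {(u, i, v). length u + (k - 1) + length v \<le> j \<and> normal u
      \<and> (i = t \<longrightarrow> \<not> ends_t u)}"

text \<open>The map \<open>h\<close> sends normal symbols injectively, by
  \<open>lw_factor_unique\<close>, to words containing a leading word; normal words contain
  none.\<close>

lemma card_normal_symbols_le:
  "card (normal_symbols j) + (\<Sum>d\<le>j. card (normal_words d)) \<le> card {w :: 'x list. length w \<le> j}"
proof -
  define h where "h = (\<lambda>(u, i, v). u @ lw i @ v)"
  have "inj_on h (normal_symbols j)"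
  proof (rule inj_onI)
    fix x y assume "x \<in> normal_symbols j" "y \<in> normal_symbols j" "h x = h y"
    then show "x = y"
      using lw_factor_unique[of "fst x" "fst (snd x)" "fst y" "fst (snd y)" "snd (snd x)" "snd (snd y)"]
      by (cases x; cases y) (simp add: normal_symbols_def h_def)
  qed
  then have card1: "card (h ` normal_symbols j) = card (normal_symbols j)"
    by (rule card_image)
  define A where "A = (\<Union>d\<le>j. normal_words d)"
  have card2: "card A = (\<Sum>d\<le>j. card (normal_words d))"
    unfolding A_def by (rule card_UN_disjoint) (simp_all add: finite_normal_words, auto simp: normal_words_def)
  have sub: "h ` normal_symbols j \<subseteq> {w. length w \<le> j}" "A \<subseteq> {w. length w \<le> j}"
    by (auto simp: h_def normal_symbols_def A_def normal_words_def)
  have "h ` normal_symbols j \<inter> A = {}"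
    by (auto simp: h_def A_def normal_words_def not_normal_lw)
  moreover have "finite (h ` normal_symbols j)" "finite A"
    using sub finite_short_words finite_subset by blast+
  ultimately have "card (h ` normal_symbols j \<union> A) = card (normal_symbols j) + (\<Sum>d\<le>j. card (normal_words d))"
    using card1 card2 by (simp add: card_Un_disjoint)
  moreover have "card (h ` normal_symbols j \<union> A) \<le> card {w :: 'x list. length w \<le> j}"
    using sub finite_short_words by (intro card_mono) auto
  ultimately show ?thesis
    by simp
qed

end

section \<open>Syzygies\<close>

definition symbols :: "nat \<Rightarrow> nat \<Rightarrow> ('x list \<times> 'x \<times> 'x list) set" where
  "symbols k j = {(u, i, v). length u + (k - 1) + length v \<le> j}"

text \<open>The coefficient of \<open>y\<close> in \<open>u r i v\<close>, where \<open>f\<close> is the coefficient function of the potential; it is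
  meaningful only for \<open>length y \<le> j\<close>.\<close>

definition word_coeff ::
    "('x list \<Rightarrow> 'r::comm_ring_1) \<Rightarrow> nat \<Rightarrow> 'x list \<times> 'x \<times> 'x list \<Rightarrow> 'x list \<Rightarrow> 'r" where
  "word_coeff f j = (\<lambda>(u, i, v) y. \<Sum>m | length m \<le> j. f (i # m) * of_bool (y = u @ m @ v))"

text \<open>Both sums expand \<open>u r l v r i w\<close>: the first writes out \<open>r l\<close>
  and keeps \<open>r i\<close> marked, the second does the opposite.\<close>

definition koszul_syzygy :: "('x list \<Rightarrow> 'r::comm_ring_1) \<Rightarrow> nat
    \<Rightarrow> 'x list \<Rightarrow> 'x \<Rightarrow> 'x list \<Rightarrow> 'x \<Rightarrow> 'x list \<Rightarrow> 'x list \<times> 'x \<times> 'x list \<Rightarrow> 'r" where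
  "koszul_syzygy f j u l v i w x =
    (\<Sum>m | length m \<le> j. f (l # m) * of_bool (x = (u @ m @ v, i, w)))
    - (\<Sum>m | length m \<le> j. f (i # m) * of_bool (x = (u, l, v @ m @ w)))"

text \<open>This is \<open>\<Sum>i. x\<^sub>i r i - r i x\<^sub>i\<close> between \<open>u\<close>
  and \<open>v\<close>, written in symbols.\<close>

definition cyclic_syzygy ::
    "'x list \<Rightarrow> 'x list \<Rightarrow> 'x::finite list \<times> 'x \<times> 'x list \<Rightarrow> 'r::comm_ring_1" where
  "cyclic_syzygy u v x =
    (\<Sum>i\<in>UNIV. of_bool (x = (u @ [i], i, v))) - (\<Sum>i\<in>UNIV. of_bool (x = (u, i, i # v)))"

lemma finite_symbols: "finite (symbols k j :: ('x::finite list \<times> 'x \<times> 'x list) set)"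
proof (rule finite_subset)
  show "(symbols k j :: ('x list \<times> 'x \<times> 'x list) set)
      \<subseteq> {m. length m \<le> j} \<times> UNIV \<times> {m. length m \<le> j}"
    by (auto simp: symbols_def)
qed (simp add: finite_short_words)

text \<open>The coefficients lie in a commutative ring rather than a field because \<open>f\<close>
  will be the pencil \<open>G + s F\<close> over \<open>K[s]\<close>.\<close>

locale cyclic_fun =
  fixes f :: "'x::finite list \<Rightarrow> 'r::comm_ring_1" and k j :: nat
  assumes k3: "3 \<le> k"
    and cyc: "f (x # u) = f (u @ [x])"
    and low: "length w < k \<Longrightarrow> f w = 0"
begin

abbreviation "Y \<equiv> {m :: 'x list. length m \<le> j}"
abbreviation "S \<equiv> symbols k j :: ('x list \<times> 'x \<times> 'x list) set"

text \<open>Relations start in degree \<open>k - 1\<close>, so other symbols contribute only words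
  longer than \<open>j\<close>. Syzygies may therefore mention symbols outside \<open>S\<close>
  without affecting the sums over \<open>S\<close>.\<close>

lemma word_coeff_outside:
  assumes "x \<notin> S" "length y \<le> j"
  shows "word_coeff f j x y = 0"
proof -
  obtain u i v where x: "x = (u, i, v)"
    by (cases x)
  have "f (i # m) * of_bool (y = u @ m @ v) = 0" for m
  proof (cases "y = u @ m @ v")
    case True
    then have "length (i # m) < k"
      using assms k3 by (simp add: x symbols_def)
    then show ?thesis
      by (simp add: low)
  qed simp
  then show ?thesis
    by (simp add: x word_coeff_def)
qed

lemma sum_delta_word_coeff:
  assumes "length y \<le> j"
  shows "(\<Sum>x\<in>S. of_bool (x = x0) * word_coeff f j x y) = word_coeff f j x0 y"
proof -
  have "(\<Sum>x\<in>S. of_bool (x = x0) * word_coeff f j x y)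
      = (\<Sum>x\<in>S. if x = x0 then word_coeff f j x0 y else 0)"
    by (rule sum.cong) auto
  also have "\<dots> = word_coeff f j x0 y"
    by (simp add: finite_symbols word_coeff_outside assms)
  finally show ?thesis .
qed

lemma sum_koszul_syzygy:
  assumes y: "length y \<le> j"
  shows "(\<Sum>x\<in>S. koszul_syzygy f j u l v i w x * word_coeff f j x y) = 0"
proof -
  have *: "(\<Sum>x\<in>S. (\<Sum>m\<in>Y. g m * of_bool (x = h m)) * word_coeff f j x y)
      = (\<Sum>m\<in>Y. g m * word_coeff f j (h m) y)" for g :: "'x list \<Rightarrow> 'r" and h
  proof -
    have "(\<Sum>x\<in>S. (\<Sum>m\<in>Y. g m * of_bool (x = h m)) * word_coeff f j x y)
        = (\<Sum>x\<in>S. \<Sum>m\<in>Y. g m * (of_bool (x = h m) * word_coeff f j x y))"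
      by (simp only: sum_distrib_right mult.assoc)
    also have "\<dots> = (\<Sum>m\<in>Y. g m * (\<Sum>x\<in>S. of_bool (x = h m) * word_coeff f j x y))"
      by (subst sum.swap) (simp only: sum_distrib_left)
    finally show ?thesis
      by (simp only: sum_delta_word_coeff[OF y])
  qed
  have "(\<Sum>m\<in>Y. f (l # m) * word_coeff f j (u @ m @ v, i, w) y)
      = (\<Sum>m\<in>Y. \<Sum>m'\<in>Y. f (l # m) * (f (i # m') * of_bool (y = u @ m @ v @ m' @ w)))"
    by (simp add: word_coeff_def sum_distrib_left)
  also have "\<dots> = (\<Sum>m'\<in>Y. \<Sum>m\<in>Y. f (l # m) * (f (i # m') * of_bool (y = u @ m @ v @ m' @ w)))"
    by (rule sum.swap)
  also have "\<dots> = (\<Sum>m\<in>Y. f (i # m) * word_coeff f j (u, l, v @ m @ w) y)"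
    by (simp add: word_coeff_def sum_distrib_left mult.left_commute)
  finally show ?thesis
    by (simp add: koszul_syzygy_def left_diff_distrib sum_subtractf *)
qed

lemma sum_cyclic_syzygy:
  assumes y: "length y \<le> j"
  shows "(\<Sum>x\<in>S. cyclic_syzygy u v x * word_coeff f j x y) = 0"
proof -
  have *: "(\<Sum>x\<in>S. (\<Sum>i\<in>UNIV. of_bool (x = h i)) * word_coeff f j x y)
      = (\<Sum>i\<in>UNIV. word_coeff f j (h i) y)" for h :: "'x \<Rightarrow> _"
    unfolding sum_distrib_right
    by (subst sum.swap) (simp only: sum_delta_word_coeff[OF y])
  \<comment> \<open>A nonempty word splits as first letter and rest or as rest and last letter;
    cyclic invariance matches the two splittings. The bound is \<open>Suc j\<close> because the
    extra letter is included.\<close>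
  define Z where "Z = {z :: 'x list. z \<noteq> [] \<and> length z \<le> Suc j}"
  have "(\<Sum>i\<in>UNIV. word_coeff f j (u @ [i], i, v) y)
      = (\<Sum>(i, m)\<in>UNIV \<times> Y. f (i # m) * of_bool (y = u @ (i # m) @ v))"
    by (simp add: word_coeff_def sum.cartesian_product)
  also have "\<dots> = (\<Sum>z\<in>Z. f z * of_bool (y = u @ z @ v))"
    by (rule sum.reindex_bij_witness[of _ "\<lambda>z. (hd z, tl z)" "\<lambda>(i, m). i # m"])
      (auto simp: Z_def)
  also have "\<dots> = (\<Sum>(i, m)\<in>UNIV \<times> Y. f (m @ [i]) * of_bool (y = u @ (m @ [i]) @ v))"
    by (rule sum.reindex_bij_witness[of _ "\<lambda>(i, m). m @ [i]" "\<lambda>z. (last z, butlast z)"])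
      (auto simp: Z_def)
  also have "\<dots> = (\<Sum>i\<in>UNIV. word_coeff f j (u, i, i # v) y)"
    by (simp add: word_coeff_def sum.cartesian_product cyc)
  finally show ?thesis
    unfolding cyclic_syzygy_def left_diff_distrib sum_subtractf * by simp
qed

end

section \<open>The special potential and its rotations\<close>

context leading_words
begin

text \<open>The support of \<open>G\<close>: the rotations of \<open>replicate (k - 2) t @ [i, \<pi> i]\<close>.\<close>

definition pot :: "'x list \<Rightarrow> bool" where
  "pot w \<longleftrightarrow> (\<exists>a c i. i \<noteq> t \<and> a + c = k - 2 \<and> w = replicate a t @ [i, \<pi> i] @ replicate c t)
    \<or> (\<exists>i. i \<noteq> t \<and> w = i # replicate (k - 2) t @ [\<pi> i])"

lemma pot_cases:
  assumes "pot w"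
  obtains (inner) a c i where "i \<noteq> t" "a + c = k - 2" "w = replicate a t @ [i, \<pi> i] @ replicate c t"
    | (outer) i where "i \<noteq> t" "w = i # replicate (k - 2) t @ [\<pi> i]"
  using assms unfolding pot_def by blast

lemma pot_innerI:
  "i \<noteq> t \<Longrightarrow> a + c = k - 2 \<Longrightarrow> w = replicate a t @ [i, \<pi> i] @ replicate c t \<Longrightarrow> pot w"
  unfolding pot_def by blast

lemma pot_outerI: "i \<noteq> t \<Longrightarrow> w = i # replicate (k - 2) t @ [\<pi> i] \<Longrightarrow> pot w"
  unfolding pot_def by blast

lemma pot_length: "pot w \<Longrightarrow> length w = k"
  using k3 by (elim pot_cases) simp_all

lemma pot_rotate1:
  assumes "pot w"
  shows "pot (rotate1 w)"
  using assms
proof (cases rule: pot_cases)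
  case (inner a c i)
  show ?thesis
  proof (cases a)
    case 0
    with inner show ?thesis
      by (intro pot_outerI[of "\<pi> i"]) simp_all
  next
    case (Suc a')
    with inner show ?thesis
      by (intro pot_innerI[of i a' "Suc c"]) (simp_all add: replicate_append_same)
  qed
next
  case (outer i)
  then show ?thesis
    by (intro pot_innerI[of "\<pi> i" "k - 2" 0]) simp_all
qed

lemma pot_cyc: "pot (x # u) \<longleftrightarrow> pot (u @ [x])"
proof
  assume "pot (x # u)"
  then show "pot (u @ [x])"
    using pot_rotate1 by force
next
  assume "pot (u @ [x])"
  \<comment> \<open>Rotating \<open>u @ [x]\<close> by \<open>length u\<close> further places yields
    \<open>x # u\<close>, so invariance in one direction suffices.\<close>
  then have "pot (rotate n (u @ [x]))" for n
    by (induction n) (simp_all add: pot_rotate1)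
  from this[of "length u"] show "pot (x # u)"
    by (simp add: rotate_append)
qed

lemma pot_lw: "pot (i # lw i)"
proof (cases "i = t")
  case True
  have "t # replicate (k - 3) t = replicate (k - 2) t"
    using k3 by (metis One_nat_def Suc_diff_Suc Suc_le_lessD numeral_2_eq_2 numeral_3_eq_3 replicate_Suc)
  then show ?thesis
    using True b_neq by (intro pot_innerI[of b "k - 2" 0]) (simp_all add: lw_def)
qed (intro pot_outerI[of i], simp_all add: lw_def)

section \<open>Lexicographic comparison through natural numbers\<close>

definition digit :: "'x \<Rightarrow> nat" where
  "digit x = (if x = t then 2 else if x = b then 1 else 0)"

text \<open>Base 3 numerals order words of equal length lexicographically by digits. Letters other
  than \<open>t\<close> and \<open>b\<close> share the digit 0, so distinct words may have equal
  value.\<close>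

definition val :: "'x list \<Rightarrow> nat" where
  "val w = foldl (\<lambda>n x. 3 * n + digit x) 0 w"

lemma val_Nil [simp]: "val [] = 0"
  by (simp add: val_def)

lemma val_snoc: "val (w @ [x]) = 3 * val w + digit x"
  by (simp add: val_def)

lemma val_append: "val (u @ v) = val u * 3 ^ length v + val v"
  by (induction v rule: rev_induct) (simp_all add: val_snoc append_assoc[symmetric] del: append_assoc)

lemma val_less: "val w < 3 ^ length w"
  by (induction w rule: rev_induct) (auto simp: val_snoc digit_def)

lemma val_mono_left:
  assumes "length v = length v'" "val u < val u'"
  shows "val (u @ v) < val (u' @ v')"
proof -
  have "val (u @ v) < (val u + 1) * 3 ^ length v"
    using val_less[of v] by (simp add: val_append)
  also have "\<dots> \<le> val u' * 3 ^ length v"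
    using assms by (intro mult_right_mono) simp_all
  finally show ?thesis
    using assms by (simp add: val_append)
qed

lemma val_mono_digit:
  assumes "length v = length v'" "digit x < digit y"
  shows "val (p @ x # v) < val (p @ y # v')"
  using val_mono_left[of v v' "p @ [x]" "p @ [y]"] assms by (simp add: val_snoc)

lemma val_mono_middle:
  assumes "length m = length m'" "val m < val m'"
  shows "val (p @ m @ q) < val (p @ m' @ q)"
  using val_mono_left[of q q "p @ m" "p @ m'"] assms by (simp add: val_append)

lemma digit_less_t: "x \<noteq> t \<Longrightarrow> digit x < digit t"
  by (simp add: digit_def)

lemma digit_less_b: "x \<noteq> t \<Longrightarrow> x \<noteq> b \<Longrightarrow> digit x < digit b"
  using b_neq by (simp add: digit_def)

text \<open>The words are compared at their first relevant difference. If
  \<open>i \<noteq> t\<close>, an inner rotation starts with \<open>\<pi> i\<close> where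
  \<open>lw i\<close> has \<open>t\<close>. If \<open>i = t\<close>, either a non-\<open>t\<close>
  letter comes too early, or the pair is at the end and begins with a letter other than
  \<open>b\<close>.\<close>

lemma pot_leading:
  assumes "pot (i # m)"
  shows "m = lw i \<or> val m < val (lw i)"
  using assms
proof (cases rule: pot_cases)
  case (outer l)
  then show ?thesis
    by (simp add: lw_def)
next
  case (inner a c l)
  obtain e where e: "k = e + 3"
    using k3 by (metis add.commute le_Suc_ex)
  show ?thesis
  proof (cases a)
    case 0
    have "val ([] @ \<pi> i # replicate (k - 2) t) < val ([] @ t # replicate e t @ [\<pi> i])"
      using inner 0 e by (intro val_mono_digit) (simp_all add: digit_less_t)
    moreover have "m = \<pi> i # replicate (k - 2) t" "lw i = t # replicate e t @ [\<pi> i]"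
      unfolding lw_def using inner 0 by (simp_all add: e)
    ultimately show ?thesis
      by simp
  next
    case (Suc a')
    then have it: "i = t" and m: "m = replicate a' t @ l # \<pi> l # replicate c t"
      using inner by simp_all
    show ?thesis
    proof (cases c)
      case 0
      then have "a' = k - 3"
        using inner Suc by simp
      then show ?thesis
        using inner 0 m it val_mono_digit[of "[\<pi> l]" "[\<pi> b]" l b "replicate (k - 3) t"]
        by (cases "l = b") (simp_all add: lw_def digit_less_b)
    next
      case (Suc c')
      have "replicate (k - 3) t = replicate a' t @ t # replicate c' t"
      proof -
        have "k - 3 = a' + Suc c'"
          using inner \<open>a = Suc a'\<close> Suc e by simp
        then show ?thesis
          by (simp add: replicate_add replicate_append_same)
      qed
      then have "lw i = replicate a' t @ t # replicate c' t @ [b, \<pi> b]"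
        by (simp add: lw_def it)
      then show ?thesis
        unfolding m using Suc inner by (intro disjI2) (simp add: val_mono_digit digit_less_t)
    qed
  qed
qed

lemma val_cyclic_left: "i \<noteq> t \<Longrightarrow> val (i # lw i) < val (t # lw t)"
  using val_mono_digit[of "lw i" "lw t" i t "[]"] by (simp add: digit_less_t)

text \<open>Equality occurs for \<open>i = \<pi> b\<close>, the single overlap of leading words; in
  the symbol order this tie is broken by the length of the prefix.\<close>

lemma val_cyclic_right: "lw i @ [i] = t # lw t \<or> val (lw i @ [i]) < val (t # lw t)"
proof -
  obtain e where e: "k = e + 3"
    using k3 by (metis add.commute le_Suc_ex)
  have tw: "t # lw t = replicate e t @ t # [b, \<pi> b]"
    unfolding lw_def by (simp add: e replicate_app_Cons_same)
  have tw': "t # lw t = replicate (k - 2) t @ b # [\<pi> b]"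
    unfolding lw_def by (simp add: e)
  show ?thesis
  proof (cases "i = t")
    case True
    have v: "val (replicate e t @ b # [\<pi> b, t]) < val (replicate e t @ t # [b, \<pi> b])"
      using b_neq by (intro val_mono_digit) (simp_all add: digit_less_t)
    have "lw i @ [i] = replicate e t @ b # [\<pi> b, t]"
      unfolding lw_def by (simp add: e True)
    from v[folded this] show ?thesis
      unfolding tw by (rule disjI2)
  next
    case False
    then have lwi: "lw i @ [i] = replicate (k - 2) t @ \<pi> i # [i]"
      by (simp add: lw_def)
    show ?thesis
    proof (cases "\<pi> i = b")
      case True
      then have "\<pi> b = i"
        by auto
      then show ?thesis
        unfolding tw' lwi using True by simp
    next
      case False
      with \<open>i \<noteq> t\<close> have "val (replicate (k - 2) t @ \<pi> i # [i]) < val (replicate (k - 2) t @ b # [\<pi> b])"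
        by (intro val_mono_digit) (simp_all add: digit_less_b)
      then show ?thesis
        unfolding tw' lwi by simp
    qed
  qed
qed

section \<open>Leading symbols of the syzygies\<close>

text \<open>The Schreyer order: compare \<open>u @ lw i @ v\<close> first, then the position of the marked factor.\<close>

definition sord :: "nat \<Rightarrow> 'x list \<times> 'x \<times> 'x list \<Rightarrow> nat" where
  "sord j = (\<lambda>(u, i, v). val (u @ lw i @ v) * Suc j + length u)"

text \<open>The factor \<open>Suc j\<close> leaves room for the prefix length of a symbol, which is
  at most \<open>j\<close>.\<close>

lemma sord_lessI:
  assumes "(u, i, v) \<in> symbols k j"
    and "val (u @ lw i @ v) < val (u' @ lw i' @ v')
      \<or> u @ lw i @ v = u' @ lw i' @ v' \<and> length u < length u'"
  shows "sord j (u, i, v) < sord j (u', i', v')"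
  using assms(2)
proof
  assume "val (u @ lw i @ v) < val (u' @ lw i' @ v')"
  then have "(val (u @ lw i @ v) + 1) * Suc j \<le> val (u' @ lw i' @ v') * Suc j"
    by (intro mult_right_mono) simp_all
  moreover have "length u < Suc j"
    using assms(1) by (simp add: symbols_def)
  ultimately show ?thesis
    by (simp add: sord_def)
qed (simp add: sord_def)

text \<open>In the first sum any \<open>m\<close> other than \<open>lw l\<close> lowers the word. In
  the second sum the word does not increase and the mark moves left to the end of \<open>u\<close>,
  so every term is smaller.\<close>

lemma koszul_leading:
  fixes G :: "'x list \<Rightarrow> 'r::comm_ring_1"
  defines "G \<equiv> \<lambda>w. of_bool (pot w)"
  assumes a: "(u @ lw l @ v, i, w) \<in> symbols k j"
  shows "koszul_syzygy G j u l v i w (u @ lw l @ v, i, w) = 1"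
    and "x \<in> symbols k j \<Longrightarrow> koszul_syzygy G j u l v i w x \<noteq> 0
      \<Longrightarrow> x = (u @ lw l @ v, i, w) \<or> sord j x < sord j (u @ lw l @ v, i, w)"
proof -
  let ?a = "(u @ lw l @ v, i, w)"
  have "lw l \<in> {m. length m \<le> j}"
    using a by (simp add: symbols_def)
  then have "(\<Sum>m | length m \<le> j. G (l # m) * of_bool (?a = (u @ m @ v, i, w))) = 1"
    by (subst sum.remove[of _ "lw l"]) (auto simp: finite_short_words G_def pot_lw intro!: sum.neutral)
  moreover have "(\<Sum>m | length m \<le> j. G (i # m) * of_bool (?a = (u, l, v @ m @ w))) = 0"
    by (intro sum.neutral) auto
  ultimately show "koszul_syzygy G j u l v i w ?a = 1"
    by (simp add: koszul_syzygy_def)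
  assume x: "x \<in> symbols k j" "koszul_syzygy G j u l v i w x \<noteq> 0"
  then consider "(\<Sum>m | length m \<le> j. G (l # m) * of_bool (x = (u @ m @ v, i, w))) \<noteq> 0"
    | "(\<Sum>m | length m \<le> j. G (i # m) * of_bool (x = (u, l, v @ m @ w))) \<noteq> 0"
    unfolding koszul_syzygy_def by fastforce
  then show "x = ?a \<or> sord j x < sord j ?a"
  proof cases
    case 1
    then obtain m where "G (l # m) * of_bool (x = (u @ m @ v, i, w)) \<noteq> 0"
      by (rule sum.not_neutral_contains_not_neutral)
    then have m: "pot (l # m)" "x = (u @ m @ v, i, w)"
      by (simp_all add: G_def of_bool_def split: if_splits)
    then have "length m = length (lw l)"
      using pot_length[OF m(1)] by simp
    show ?thesis
    proof (cases "m = lw l")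
      case False
      then have "val m < val (lw l)"
        using pot_leading[OF m(1)] by simp
      then have "val (u @ m @ (v @ lw i @ w)) < val (u @ lw l @ (v @ lw i @ w))"
        using \<open>length m = length (lw l)\<close> by (intro val_mono_middle)
      then show ?thesis
        using x m by (intro disjI2) (simp add: sord_lessI)
    qed (use m in simp)
  next
    case 2
    then obtain m where "G (i # m) * of_bool (x = (u, l, v @ m @ w)) \<noteq> 0"
      by (rule sum.not_neutral_contains_not_neutral)
    then have m: "pot (i # m)" "x = (u, l, v @ m @ w)"
      by (simp_all add: G_def of_bool_def split: if_splits)
    then have len: "length m = length (lw i)"
      using pot_length[OF m(1)] by simp
    have "length u < length (u @ lw l @ v)"
      using k3 by simp
    moreover have "m = lw i \<or> val ((u @ lw l @ v) @ m @ w) < val ((u @ lw l @ v) @ lw i @ w)"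
      using pot_leading[OF m(1)] len val_mono_middle by blast
    ultimately have "sord j x < sord j ?a"
      using x(1) unfolding m(2) by (intro sord_lessI) auto
    then show ?thesis ..
  qed
qed

text \<open>Terms \<open>(u @ [i], i, v)\<close> with \<open>i \<noteq> t\<close> have a smaller
  word; terms \<open>(u, i, i # v)\<close> have at most the same word and a shorter prefix.\<close>

lemma cyclic_leading:
  assumes "(u @ [t], t, v) \<in> symbols k j"
  shows "(cyclic_syzygy u v (u @ [t], t, v) :: 'r::comm_ring_1) = 1"
    and "x \<in> symbols k j \<Longrightarrow> (cyclic_syzygy u v x :: 'r::comm_ring_1) \<noteq> 0
      \<Longrightarrow> x = (u @ [t], t, v) \<or> sord j x < sord j (u @ [t], t, v)"
proof -
  let ?a = "(u @ [t], t, v)"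
  have "(\<Sum>i\<in>UNIV. of_bool (?a = (u @ [i], i, v))) = (1 :: 'r)"
    by (subst sum.remove[of _ t]) (auto intro!: sum.neutral)
  moreover have "(\<Sum>i\<in>UNIV. of_bool (?a = (u, i, i # v))) = (0 :: 'r)"
    by (intro sum.neutral) auto
  ultimately show "(cyclic_syzygy u v ?a :: 'r::comm_ring_1) = 1"
    by (simp add: cyclic_syzygy_def)
  assume x: "x \<in> symbols k j" "(cyclic_syzygy u v x :: 'r::comm_ring_1) \<noteq> 0"
  then consider "(\<Sum>i\<in>UNIV. of_bool (x = (u @ [i], i, v))) \<noteq> (0 :: 'r)"
    | "(\<Sum>i\<in>UNIV. of_bool (x = (u, i, i # v))) \<noteq> (0 :: 'r)"
    unfolding cyclic_syzygy_def by fastforce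
  then show "x = ?a \<or> sord j x < sord j ?a"
  proof cases
    case 1
    then obtain i where "of_bool (x = (u @ [i], i, v)) \<noteq> (0 :: 'r)"
      by (rule sum.not_neutral_contains_not_neutral)
    then have i: "x = (u @ [i], i, v)"
      by simp
    show ?thesis
    proof (cases "i = t")
      case False
      then have "val (u @ (i # lw i) @ v) < val (u @ (t # lw t) @ v)"
        by (intro val_mono_middle val_cyclic_left) simp
      then show ?thesis
        using x i by (intro disjI2) (simp add: sord_lessI)
    qed (use i in simp)
  next
    case 2
    then obtain i where "of_bool (x = (u, i, i # v)) \<noteq> (0 :: 'r)"
      by (rule sum.not_neutral_contains_not_neutral)
    then have i: "x = (u, i, i # v)"
      by simp
    have "lw i @ [i] = t # lw t \<or> val (u @ (lw i @ [i]) @ v) < val (u @ (t # lw t) @ v)"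
      using val_cyclic_right[of i] val_mono_middle[of "lw i @ [i]" "t # lw t" u v] by auto
    then have "u @ (lw i @ [i]) @ v = u @ (t # lw t) @ v
        \<or> val (u @ (lw i @ [i]) @ v) < val (u @ (t # lw t) @ v)"
      by metis
    then have "sord j x < sord j ?a"
      using x(1) unfolding i by (intro sord_lessI) auto
    then show ?thesis ..
  qed
qed

text \<open>The syzygies of the pencil \<open>G + s F\<close> led by the symbols in \<open>L\<close>
  are independent at \<open>s = 0\<close>, and the images of \<open>V\<close> are independent at
  infinity. Hence \<open>card_add_le_of_complex\<close> applies, and \<open>card S - card L\<close>
  counts the normal symbols.\<close>

theorem card_independent_le:
  fixes F :: "'x list \<Rightarrow> 'k::field"
  assumes cyc: "\<And>x u. F (x # u) = F (u @ [x])" and low: "\<And>w. length w < k \<Longrightarrow> F w = 0"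
    and V: "V \<subseteq> symbols k j"
    and ind: "\<And>c v. (\<And>y. length y \<le> j \<Longrightarrow> (\<Sum>v\<in>V. c v * word_coeff F j v y) = 0) \<Longrightarrow> v \<in> V \<Longrightarrow> c v = 0"
  shows "card V \<le> card (normal_symbols j)"
proof -
  define S where "S = (symbols k j :: ('x list \<times> 'x \<times> 'x list) set)"
  define L where "L = S - normal_symbols j"
  define G where "G w = (of_bool (pot w) :: 'k)" for w
  define f where "f w = [:G w, F w:]" for w
  have finS: "finite S"
    unfolding S_def by (rule finite_symbols)
  interpret cyclic_fun f k j
  proof
    show "f (x # u) = f (u @ [x])" for x u
      unfolding f_def G_def cyc pot_cyc ..
    show "f w = 0" if "length w < k" for w
      using that low pot_length[of w] by (auto simp: f_def G_def)
  qed (rule k3)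
  have f_coeff: "word_coeff f j x y = [:word_coeff G j x y, word_coeff F j x y:]" for x y
  proof -
    have "(\<Sum>m\<in>M. [:g m, h m:] * of_bool (P m)) = [:\<Sum>m\<in>M. g m * of_bool (P m), \<Sum>m\<in>M. h m * of_bool (P m):]"
      for g h :: "'x list \<Rightarrow> 'k" and P M
      by (induction M rule: infinite_finite_induct) auto
    then show ?thesis
      by (cases x) (simp add: word_coeff_def f_def)
  qed
  have of_bool_coeff: "coeff (of_bool P :: 'k poly) 0 = of_bool P" for P
    by (cases P) simp_all
  \<comment> \<open>A syzygy of the whole pencil whose specialisation at \<open>s = 0\<close> has
    leading symbol \<open>a\<close> with coefficient 1.\<close>
  define good where "good a \<tau> \<longleftrightarrow>
      (\<forall>y. length y \<le> j \<longrightarrow> (\<Sum>x\<in>S. \<tau> x * word_coeff f j x y) = 0) \<and> coeff (\<tau> a) 0 = 1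
      \<and> (\<forall>x\<in>S. coeff (\<tau> x) 0 \<noteq> 0 \<longrightarrow> x = a \<or> sord j x < sord j a)" for a \<tau>
  \<comment> \<open>A prefix containing some \<open>lw l\<close> is led by a Koszul syzygy. A normal
    prefix can fail only by ending in \<open>t\<close> before the mark \<open>t\<close>, and is then
    led by a cyclic syzygy.\<close>
  have ex: "\<exists>\<tau>. good a \<tau>" if a: "a \<in> L" for a
  proof -
    obtain u i v where uiv: "a = (u, i, v)"
      by (cases a)
    have aS: "(u, i, v) \<in> symbols k j" and an: "\<not> normal u \<or> i = t \<and> ends_t u"
      using a by (auto simp: uiv L_def S_def symbols_def normal_symbols_def)
    show ?thesis
    proof (cases "normal u")
      case False
      then obtain p l q where u: "u = p @ lw l @ q"
        unfolding normal_def by blast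
      have "coeff (koszul_syzygy f j p l q i v x) 0 = koszul_syzygy G j p l q i v x" for x
        by (simp add: koszul_syzygy_def coeff_sum f_def coeff_mult_0 of_bool_coeff)
      then show ?thesis
        using koszul_leading[where 'r = 'k, of p l q i v j] sum_koszul_syzygy[of _ p l q i v] aS
        unfolding uiv u S_def G_def good_def
        by (intro exI[of _ "koszul_syzygy f j p l q i v"]) simp
    next
      case True
      then have "i = t" "ends_t u"
        using an by auto
      then obtain p where u: "u = p @ [t]"
        unfolding ends_t_def by (metis append_butlast_last_id)
      have "coeff (cyclic_syzygy p v x) 0 = (cyclic_syzygy p v x :: 'k)" for x
        by (simp add: cyclic_syzygy_def coeff_sum of_bool_coeff del: sum_of_bool_eq)
      then show ?thesis
        using cyclic_leading[where 'r = 'k, of p v j] sum_cyclic_syzygy[of _ p v] aS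
        unfolding uiv u S_def \<open>i = t\<close> good_def
        by (intro exI[of _ "cyclic_syzygy p v"]) simp
    qed
  qed
  define \<sigma> where "\<sigma> a = (SOME \<tau>. good a \<tau>)" for a
  have "good a (\<sigma> a)" if "a \<in> L" for a
    unfolding \<sigma>_def by (rule someI_ex[OF ex[OF that]])
  then have \<sigma>: "\<And>a y. a \<in> L \<Longrightarrow> length y \<le> j \<Longrightarrow> (\<Sum>x\<in>S. \<sigma> a x * word_coeff f j x y) = 0"
    "\<And>a. a \<in> L \<Longrightarrow> coeff (\<sigma> a a) 0 = 1"
    "\<And>a x. a \<in> L \<Longrightarrow> x \<in> S \<Longrightarrow> coeff (\<sigma> a x) 0 \<noteq> 0 \<Longrightarrow> x = a \<or> sord j x < sord j a"
    unfolding good_def by blast+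
  have LS: "L \<subseteq> S" "finite L"
    using finS by (auto simp: L_def)
  have "card V + card L \<le> card S"
  proof (rule card_add_le_of_complex[where Y = "{y. length y \<le> j}" and \<sigma> = \<sigma>
        and \<phi> = "word_coeff G j" and \<psi> = "word_coeff F j"])
    show "c a = 0" if rel: "\<And>x. x \<in> S \<Longrightarrow> (\<Sum>a\<in>L. c a * coeff (\<sigma> a x) 0) = 0" and "a \<in> L" for c a
    proof (rule triangular_independent[where L = L and \<tau> = "\<lambda>a x. coeff (\<sigma> a x) 0" and ord = "sord j"])
      show "coeff (\<sigma> a a) 0 \<noteq> 0" if "a \<in> L" for a
        using \<sigma>(2)[OF that] by simp
      show "x = a \<or> sord j x < sord j a" if "a \<in> L" "x \<in> L" "coeff (\<sigma> a x) 0 \<noteq> 0" for a x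
        using \<sigma>(3)[OF that(1) _ that(3)] that(2) LS(1) by blast
      show "(\<Sum>a\<in>L. c a * coeff (\<sigma> a x) 0) = 0" if "x \<in> L" for x
        using rel that LS(1) by blast
    qed (use LS \<open>a \<in> L\<close> in simp_all)
    show "(\<Sum>x\<in>S. \<sigma> a x * [:word_coeff G j x y, word_coeff F j x y:]) = 0"
      if "a \<in> L" "y \<in> {y. length y \<le> j}" for a y
      using \<sigma>(1)[of a y] that unfolding f_coeff by simp
    show "c v = 0" if "\<And>y. y \<in> {y. length y \<le> j} \<Longrightarrow> (\<Sum>v\<in>V. c v * word_coeff F j v y) = 0" "v \<in> V" for c v
      using ind[of c v] that by simp
  qed (use finS LS V in \<open>simp_all add: S_def\<close>)
  moreover have "card L = card S - card (normal_symbols j)" "card (normal_symbols j) \<le> card S"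
  proof -
    have "normal_symbols j \<subseteq> S"
      by (auto simp: normal_symbols_def S_def symbols_def)
    then show "card L = card S - card (normal_symbols j)" "card (normal_symbols j) \<le> card S"
      unfolding L_def using finS by (auto intro: card_Diff_subset card_mono finite_subset)
  qed
  ultimately show ?thesis
    by simp
qed

end

section \<open>Truncations of the potential algebra\<close>

lemma lookup_scalar_mult:
  "Poly_Mapping.lookup (scalar c * f) y = c * Poly_Mapping.lookup f y"
proof -
  have "scalar c * f = Poly_Mapping.map ((*) c) f"
    by (simp add: scalar_def mult_map_scale_conv_mult zero_list_def)
  then show ?thesis
    by (simp add: Poly_Mapping.map.rep_eq when_def)
qed

lemma lookup_mon: "Poly_Mapping.lookup (mon w) y = of_bool (y = w)"
  by (auto simp: mon_def lookup_single when_def)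

lemma scalar_0 [simp]: "scalar 0 = 0"
  by (simp add: scalar_def)

lemma scalar_1 [simp]: "scalar 1 = 1"
  by (simp add: scalar_def zero_list_def[symmetric])

lemma scalar_add: "scalar (a + b) = scalar a + scalar b"
  by (simp add: scalar_def single_add)

lemma scalar_mult: "scalar (a * b) = scalar a * scalar b"
  by (simp add: scalar_def mult_single plus_list_def)

lemma scalar_uminus: "scalar (- a) = - scalar a"
  by (simp add: scalar_def single_uminus)

lemma expand_mon:
  fixes f :: "('x, 'k::field) free_alg"
  shows "(\<Sum>w\<in>Poly_Mapping.keys f. scalar (Poly_Mapping.lookup f w) * mon w) = f"
proof (rule poly_mapping_eqI)
  fix y
  have "Poly_Mapping.lookup (\<Sum>w\<in>Poly_Mapping.keys f. scalar (Poly_Mapping.lookup f w) * mon w) y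
      = (\<Sum>w\<in>Poly_Mapping.keys f. if y = w then Poly_Mapping.lookup f w else 0)"
    unfolding lookup_sum by (rule sum.cong) (auto simp: lookup_scalar_mult lookup_mon)
  also have "\<dots> = Poly_Mapping.lookup f y"
    by (simp add: in_keys_iff)
  finally show "Poly_Mapping.lookup (\<Sum>w\<in>Poly_Mapping.keys f. scalar (Poly_Mapping.lookup f w) * mon w) y
      = Poly_Mapping.lookup f y" .
qed

lemma scalar_commute: "f * scalar c = scalar c * (f :: ('x, 'k::field) free_alg)"
proof -
  have "f * scalar c = (\<Sum>w\<in>Poly_Mapping.keys f. scalar (Poly_Mapping.lookup f w) * mon w * scalar c)"
    by (subst expand_mon[of f, symmetric]) (simp add: sum_distrib_right)
  also have "\<dots> = (\<Sum>w\<in>Poly_Mapping.keys f. scalar c * (scalar (Poly_Mapping.lookup f w) * mon w))"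
    by (simp add: scalar_def mon_def mult_single plus_list_def mult.commute)
  also have "\<dots> = scalar c * f"
    unfolding sum_distrib_left[symmetric] expand_mon ..
  finally show ?thesis .
qed

global_interpretation fa: vector_space "\<lambda>c (f :: ('x, 'k::field) free_alg). scalar c * f"
  by standard (simp_all add: ring_distribs scalar_add scalar_mult mult.assoc)

lemma lookup_lin_ext:
  assumes "\<And>w. Poly_Mapping.lookup (f w) y = of_bool (w = w0)"
  shows "Poly_Mapping.lookup (lin_ext f F) y = Poly_Mapping.lookup F w0"
proof -
  have "Poly_Mapping.lookup (lin_ext f F) y
      = (\<Sum>w\<in>Poly_Mapping.keys F. if w = w0 then Poly_Mapping.lookup F w else 0)"
    unfolding lin_ext_def lookup_sum by (rule sum.cong) (simp_all add: lookup_scalar_mult assms)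
  then show ?thesis
    by (simp add: in_keys_iff)
qed

lemma lookup_cyc_shift:
  "Poly_Mapping.lookup (cyc_shift F) (u @ [x]) = Poly_Mapping.lookup F (x # u)"
  unfolding cyc_shift_def
  by (rule lookup_lin_ext) (auto simp: lookup_mon lookup_one zero_list_def when_def split: list.split)

lemma lookup_hom_comp:
  "Poly_Mapping.lookup (hom_comp (length y) F) y = Poly_Mapping.lookup F y"
  unfolding hom_comp_def by (rule lookup_lin_ext) (auto simp: lookup_mon)

lemma lookup_nc_deriv:
  "Poly_Mapping.lookup (nc_deriv x F) v = Poly_Mapping.lookup F (x # v)"
  unfolding nc_deriv_def by (rule lookup_lin_ext) (auto simp: lookup_mon split: list.split)

text \<open>A linear model, inside the free algebra, of the quotient by words longer than
  \<open>j\<close>.\<close>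

definition trunc :: "nat \<Rightarrow> ('x, 'k::field) free_alg \<Rightarrow> ('x, 'k) free_alg" where
  "trunc j = lin_ext (\<lambda>w. if length w \<le> j then mon w else 0)"

lemma lookup_trunc:
  "Poly_Mapping.lookup (trunc j F) y = (if length y \<le> j then Poly_Mapping.lookup F y else 0)"
proof (cases "length y \<le> j")
  case True
  then have "Poly_Mapping.lookup (trunc j F) y = Poly_Mapping.lookup F y"
    unfolding trunc_def by (intro lookup_lin_ext) (auto simp: lookup_mon)
  with True show ?thesis
    by simp
next
  case False
  then have "Poly_Mapping.lookup (trunc j F) y = 0"
    unfolding trunc_def lin_ext_def lookup_sum
    by (intro sum.neutral) (auto simp: lookup_scalar_mult lookup_mon)
  with False show ?thesis
    by simp
qed

lemma trunc_add: "trunc j (f + g) = trunc j f + trunc j g"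
  by (rule poly_mapping_eqI) (simp add: lookup_trunc lookup_add)

lemma trunc_scalar_mult: "trunc j (scalar c * f) = scalar c * trunc j f"
  by (rule poly_mapping_eqI) (simp add: lookup_trunc lookup_scalar_mult)

lemma trunc_0 [simp]: "trunc j 0 = 0"
  by (rule poly_mapping_eqI) (simp add: lookup_trunc)

lemma trunc_mon: "trunc j (mon w) = (if length w \<le> j then mon w else 0)"
  by (rule poly_mapping_eqI) (auto simp: lookup_trunc lookup_mon)

lemma trunc_span:
  assumes "f \<in> fa.span X"
  shows "trunc j f \<in> fa.span (trunc j ` X)"
  using assms
  by (induction rule: fa.span_induct_alt)
    (auto simp: trunc_add trunc_scalar_mult intro: fa.span_zero fa.span_add fa.span_scale fa.span_base)

definition rel_mult :: "('x, 'k::field) free_alg \<Rightarrow> 'x list \<times> 'x \<times> 'x list \<Rightarrow> ('x, 'k) free_alg" where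
  "rel_mult F = (\<lambda>(u, i, v). mon u * nc_deriv i F * mon v)"

lemma lookup_rel_mult:
  fixes F :: "('x::finite, 'k::field) free_alg"
  assumes y: "length y \<le> j"
  shows "Poly_Mapping.lookup (rel_mult F x) y = word_coeff (Poly_Mapping.lookup F) j x y"
proof -
  obtain u i v where x: "x = (u, i, v)"
    by (cases x)
  define r where "r = nc_deriv i F"
  have "mon u * r * mon v = (\<Sum>m\<in>Poly_Mapping.keys r. scalar (Poly_Mapping.lookup r m) * mon (u @ m @ v))"
  proof -
    have "mon u * r * mon v
        = (\<Sum>m\<in>Poly_Mapping.keys r. mon u * (scalar (Poly_Mapping.lookup r m) * mon m) * mon v)"
      by (subst expand_mon[of r, symmetric]) (simp add: sum_distrib_left sum_distrib_right)
    also have "\<dots> = (\<Sum>m\<in>Poly_Mapping.keys r. scalar (Poly_Mapping.lookup r m) * mon (u @ m @ v))"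
      by (simp add: mon_def scalar_def mult_single plus_list_def)
    finally show ?thesis .
  qed
  then have "Poly_Mapping.lookup (rel_mult F x) y
      = (\<Sum>m\<in>Poly_Mapping.keys r. Poly_Mapping.lookup r m * of_bool (y = u @ m @ v))"
    by (simp add: rel_mult_def x r_def lookup_sum lookup_scalar_mult lookup_mon)
  also have "\<dots> = (\<Sum>m | length m \<le> j. Poly_Mapping.lookup r m * of_bool (y = u @ m @ v))"
    by (rule sum.mono_neutral_cong) (use y in \<open>auto simp: in_keys_iff finite_short_words\<close>)
  also have "\<dots> = word_coeff (Poly_Mapping.lookup F) j x y"
    by (simp add: word_coeff_def x r_def lookup_nc_deriv)
  finally show ?thesis .
qed

section \<open>The truncated ideal as a linear span\<close>

definition ideal_span :: "('x, 'k::field) free_alg \<Rightarrow> nat \<Rightarrow> ('x, 'k) free_alg set" where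
  "ideal_span F j = fa.span (range (rel_mult F) \<union> {mon w |w. length w > j})"

lemma ideal_span_mon_left:
  assumes "f \<in> ideal_span F j"
  shows "mon w * f \<in> ideal_span F j"
  using assms unfolding ideal_span_def
proof (induction rule: fa.span_induct_alt)
  case base
  then show ?case
    by (simp add: fa.span_zero)
next
  case (step c x y)
  have mem: "mon w * x \<in> range (rel_mult F) \<union> {mon w |w. length w > j}"
    using step(1)
  proof
    assume "x \<in> range (rel_mult F)"
    then obtain u i v where "x = rel_mult F (u, i, v)"
      by auto
    then have "mon w * x = rel_mult F (w @ u, i, v)"
      by (simp add: rel_mult_def mon_mult[symmetric] mult.assoc)
    then show ?thesis
      by simp
  next
    assume "x \<in> {mon w |w. length w > j}"
    then obtain w' where "x = mon w'" "length w' > j"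
      by auto
    then show ?thesis
      by (auto simp: mon_mult)
  qed
  have eq: "mon w * (scalar c * x + y) = scalar c * (mon w * x) + mon w * y"
    by (simp add: ring_distribs mult.assoc[symmetric] scalar_commute)
  show ?case
    unfolding eq by (intro fa.span_add fa.span_scale fa.span_base mem step(2))
qed

lemma ideal_span_mon_right:
  assumes "f \<in> ideal_span F j"
  shows "f * mon w \<in> ideal_span F j"
  using assms unfolding ideal_span_def
proof (induction rule: fa.span_induct_alt)
  case base
  then show ?case
    by (simp add: fa.span_zero)
next
  case (step c x y)
  have mem: "x * mon w \<in> range (rel_mult F) \<union> {mon w |w. length w > j}"
    using step(1)
  proof
    assume "x \<in> range (rel_mult F)"
    then obtain u i v where "x = rel_mult F (u, i, v)"
      by auto
    then have "x * mon w = rel_mult F (u, i, v @ w)"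
      by (simp add: rel_mult_def mon_mult[symmetric] mult.assoc)
    then show ?thesis
      by simp
  next
    assume "x \<in> {mon w |w. length w > j}"
    then obtain w' where "x = mon w'" "length w' > j"
      by auto
    then show ?thesis
      by (auto simp: mon_mult)
  qed
  have eq: "(scalar c * x + y) * mon w = scalar c * (x * mon w) + y * mon w"
    by (simp add: ring_distribs mult.assoc)
  show ?case
    unfolding eq by (intro fa.span_add fa.span_scale fa.span_base mem step(2))
qed

lemma free_alg_ring_simps [simp]:
  "carrier free_alg_ring = UNIV" "x \<otimes>\<^bsub>free_alg_ring\<^esub> y = x * y" "\<one>\<^bsub>free_alg_ring\<^esub> = 1"
  "\<zero>\<^bsub>free_alg_ring\<^esub> = 0" "x \<oplus>\<^bsub>free_alg_ring\<^esub> y = x + y"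
  by (simp_all add: free_alg_ring_def)

lemma free_alg_ring_a_inv [simp]:
  "\<ominus>\<^bsub>free_alg_ring\<^esub> (x :: ('x, 'k::field) free_alg) = - x"
proof -
  interpret ring "free_alg_ring :: ('x, 'k) free_alg ring"
    by (rule ring_free_alg_ring)
  show ?thesis
    using add.inv_equality[of "- x" x] by (simp add: a_inv_def)
qed

lemma ideal_ideal_span:
  "ideal (ideal_span F j) (free_alg_ring :: ('x, 'k::field) free_alg ring)"
proof (rule idealI[OF ring_free_alg_ring])
  interpret ring "free_alg_ring :: ('x, 'k) free_alg ring"
    by (rule ring_free_alg_ring)
  show "subgroup (ideal_span F j) (add_monoid (free_alg_ring :: ('x, 'k) free_alg ring))"
    by (rule add.subgroupI)
      (auto simp: ideal_span_def a_inv_def[symmetric] intro: fa.span_zero fa.span_add fa.span_neg)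
next
  fix f g assume f: "f \<in> ideal_span F j"
  have "(\<Sum>w\<in>Poly_Mapping.keys g. scalar (Poly_Mapping.lookup g w) * (mon w * f)) \<in> ideal_span F j"
    unfolding ideal_span_def
    by (intro fa.span_sum fa.span_scale) (rule ideal_span_mon_left[OF f, unfolded ideal_span_def])
  also have "(\<Sum>w\<in>Poly_Mapping.keys g. scalar (Poly_Mapping.lookup g w) * (mon w * f)) = g * f"
    by (simp only: expand_mon mult.assoc[symmetric] sum_distrib_right[symmetric])
  finally show "g \<otimes>\<^bsub>free_alg_ring\<^esub> f \<in> ideal_span F j"
    by simp
  have "(\<Sum>w\<in>Poly_Mapping.keys g. scalar (Poly_Mapping.lookup g w) * (f * mon w)) \<in> ideal_span F j"
    unfolding ideal_span_def
    by (intro fa.span_sum fa.span_scale) (rule ideal_span_mon_right[OF f, unfolded ideal_span_def])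
  also have "(\<Sum>w\<in>Poly_Mapping.keys g. scalar (Poly_Mapping.lookup g w) * (f * mon w)) = f * g"
  proof -
    have "scalar c * (f * h) = f * (scalar c * h)" for c h
      unfolding mult.assoc[symmetric] scalar_commute ..
    then show ?thesis
      by (simp only: expand_mon sum_distrib_left[symmetric])
  qed
  finally show "f \<otimes>\<^bsub>free_alg_ring\<^esub> g \<in> ideal_span F j"
    by simp
qed

text \<open>The span is an ideal containing all generators. A lower bound for the quotient calls
  only for an upper bound on the ideal.\<close>

lemma trunc_ideal_subset:
  fixes F :: "('x, 'k::field) free_alg"
  shows "trunc_ideal F j \<subseteq> ideal_span F j"
proof -
  interpret ring "free_alg_ring :: ('x, 'k) free_alg ring"
    by (rule ring_free_alg_ring)
  interpret I: ideal "ideal_span F j" "free_alg_ring :: ('x, 'k) free_alg ring"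
    by (rule ideal_ideal_span)
  have "nc_deriv x F \<in> ideal_span F j" for x
  proof -
    have "nc_deriv x F = rel_mult F ([], x, [])"
      by (simp add: rel_mult_def mon_Nil)
    then show ?thesis
      by (simp add: ideal_span_def fa.span_base)
  qed
  then have "potential_ideal F \<subseteq> ideal_span F j"
    unfolding potential_ideal_def by (intro genideal_minimal ideal_ideal_span) auto
  moreover have "high_degree_ideal j \<subseteq> ideal_span F j"
    unfolding high_degree_ideal_def
    by (intro genideal_minimal ideal_ideal_span) (auto simp: ideal_span_def intro: fa.span_base)
  ultimately show ?thesis
    unfolding trunc_ideal_def set_add_def' using I.a_closed by auto
qed

lemma ideal_trunc_ideal: "ideal (trunc_ideal F j) (free_alg_ring :: ('x, 'k::field) free_alg ring)"
proof -
  interpret ring "free_alg_ring :: ('x, 'k) free_alg ring"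
    by (rule ring_free_alg_ring)
  show ?thesis
    unfolding trunc_ideal_def potential_ideal_def high_degree_ideal_def
    by (intro add_ideals genideal_ideal) simp_all
qed

lemma mon_in_trunc_ideal:
  fixes F :: "('x, 'k::field) free_alg"
  assumes "length w > j"
  shows "mon w \<in> trunc_ideal F j"
proof -
  interpret ring "free_alg_ring :: ('x, 'k) free_alg ring"
    by (rule ring_free_alg_ring)
  interpret P: ideal "potential_ideal F" "free_alg_ring :: ('x, 'k) free_alg ring"
    unfolding potential_ideal_def by (rule genideal_ideal) simp
  have "{mon w |w. length w > j} \<subseteq> (high_degree_ideal j :: ('x, 'k) free_alg set)"
    unfolding high_degree_ideal_def by (rule genideal_self) simp
  then have "mon w \<in> (high_degree_ideal j :: ('x, 'k) free_alg set)"
    using assms by blast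
  moreover have "(0 :: ('x, 'k) free_alg) \<in> potential_ideal F"
    using P.zero_closed by simp
  moreover have "mon w = 0 + (mon w :: ('x, 'k) free_alg)"
    by simp
  ultimately show ?thesis
    unfolding trunc_ideal_def set_add_def' free_alg_ring_simps by blast
qed

lemma trunc_ideal_span:
  assumes low: "\<And>w. length w < k \<Longrightarrow> Poly_Mapping.lookup F w = 0" and "f \<in> trunc_ideal F j"
    and "3 \<le> k"
  shows "trunc j f \<in> fa.span ((\<lambda>x. trunc j (rel_mult F x)) ` (symbols k j :: ('x::finite list \<times> 'x \<times> 'x list) set))"
    (is "_ \<in> fa.span ?B")
proof -
  have "f \<in> fa.span (range (rel_mult F) \<union> {mon w |w. length w > j})"
    using trunc_ideal_subset assms(2) by (auto simp: ideal_span_def)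
  then have *: "trunc j f \<in> fa.span (trunc j ` (range (rel_mult F) \<union> {mon w |w. length w > j}))"
    by (rule trunc_span)
  have "fa.span (trunc j ` (range (rel_mult F) \<union> {mon w |w. length w > j})) \<subseteq> fa.span ?B"
  proof (rule fa.span_minimal[OF _ fa.subspace_span], rule subsetI)
    fix g assume "g \<in> trunc j ` (range (rel_mult F) \<union> {mon w |w. length w > j})"
    then consider u i v where "g = trunc j (rel_mult F (u, i, v))" | "g = 0"
      by (auto simp: trunc_mon)
    then show "g \<in> fa.span ?B"
    proof cases
      case 1
      show ?thesis
      proof (cases "(u, i, v) \<in> symbols k j")
        case True
        then show ?thesis
          unfolding 1 by (auto intro: fa.span_base)
      next
        case False
        \<comment> \<open>Outside \<open>symbols k j\<close>, a product of length at most
          \<open>j\<close> leaves fewer than \<open>k - 1\<close> letters for \<open>m\<close>,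
          where the relation has no terms.\<close>
        have "Poly_Mapping.lookup F (i # m) * of_bool (y = u @ m @ v) = 0" if "length y \<le> j" for m y
        proof (cases "y = u @ m @ v")
          case True
          then have "length (i # m) < k"
            using that False \<open>3 \<le> k\<close> by (simp add: symbols_def)
          then show ?thesis
            using low by simp
        qed simp
        then have "g = 0"
          unfolding 1 by (intro poly_mapping_eqI) (auto simp: lookup_trunc lookup_rel_mult word_coeff_def intro!: sum.neutral)
        then show ?thesis
          by (simp add: fa.span_zero)
      qed
    qed (simp add: fa.span_zero)
  qed
  then show ?thesis
    using * by (rule subsetD)
qed

section \<open>Dimension of the truncated algebra\<close>

lemma subfield_scalars:
  "subfield (range scalar) (free_alg_ring :: ('x, 'k::field) free_alg ring)"
proof -
  let ?R = "free_alg_ring :: ('x, 'k) free_alg ring"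
  interpret ring ?R
    by (rule ring_free_alg_ring)
  have "subring (range scalar) ?R"
  proof (rule subringI)
    show "\<one>\<^bsub>?R\<^esub> \<in> range scalar"
      by (rule range_eqI[of _ _ 1]) simp
    show "\<ominus>\<^bsub>?R\<^esub> x \<in> range scalar" if "x \<in> range scalar" for x
      using that by (auto simp: scalar_uminus[symmetric])
    show "x \<otimes>\<^bsub>?R\<^esub> y \<in> range scalar" if "x \<in> range scalar" "y \<in> range scalar" for x y
      using that by (auto simp: scalar_mult[symmetric])
    show "x \<oplus>\<^bsub>?R\<^esub> y \<in> range scalar" if "x \<in> range scalar" "y \<in> range scalar" for x y
      using that by (auto simp: scalar_add[symmetric])
  qed simp
  then have "subcring (range scalar) ?R"
    by (rule subcringI) (auto simp: scalar_mult[symmetric] mult.commute)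
  moreover have "Units (?R \<lparr>carrier := range scalar\<rparr>) = range scalar - {\<zero>\<^bsub>?R\<^esub>}"
  proof
    show "Units (?R \<lparr>carrier := range scalar\<rparr>) \<subseteq> range scalar - {\<zero>\<^bsub>?R\<^esub>}"
      unfolding Units_def by auto
    show "range scalar - {\<zero>\<^bsub>?R\<^esub>} \<subseteq> Units (?R \<lparr>carrier := range scalar\<rparr>)"
    proof
      fix x :: "('x, 'k) free_alg" assume "x \<in> range scalar - {\<zero>\<^bsub>?R\<^esub>}"
      then obtain c where c: "x = scalar c" and "x \<noteq> 0"
        by auto
      then have "c \<noteq> 0"
        by auto
      with c have "scalar (inverse c) * x = 1" "x * scalar (inverse c) = 1"
        by (simp_all add: scalar_mult[symmetric])
      then show "x \<in> Units (?R \<lparr>carrier := range scalar\<rparr>)"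
        unfolding Units_def using c(1) by auto
    qed
  qed
  ultimately show ?thesis
    by (rule subfieldI)
qed

text \<open>Lifts of a basis of the quotient, truncated, together with \<open>B\<close> span all
  words of length at most \<open>j\<close>. These words are independent, so they are at most as
  numerous as the spanning set.\<close>

lemma card_short_words_le:
  fixes F :: "('x::finite, 'k::field) free_alg"
  assumes proper: "1 \<notin> trunc_ideal F j"
    and B: "finite B" "\<And>f. f \<in> trunc_ideal F j \<Longrightarrow> trunc j f \<in> fa.span B"
  shows "card {w :: 'x list. length w \<le> j} \<le> trunc_dim F j + card B"
proof -
  define T where "T = trunc_ideal F j"
  define Q where "Q = trunc_algebra F j"
  define K where "K = trunc_scalars F j"
  let ?R = "free_alg_ring :: ('x, 'k) free_alg ring"
  define h where "h f = T +>\<^bsub>?R\<^esub> f" for f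
  interpret R: ring ?R
    by (rule ring_free_alg_ring)
  interpret I: ideal T ?R
    unfolding T_def by (rule ideal_trunc_ideal)
  have Q: "Q = ?R Quot T"
    by (simp add: Q_def trunc_algebra_def T_def)
  have h: "h = (+>\<^bsub>?R\<^esub>) T"
    by (simp add: h_def fun_eq_iff)
  interpret Q: ring Q
    unfolding Q by (rule I.quotient_is_ring)
  interpret h: ring_hom_ring ?R Q h
    unfolding Q h by (rule I.rcos_ring_hom_ring)
  have h_eq: "h f = h g \<longleftrightarrow> f - g \<in> T" for f g
    using R.quotient_eq_iff_same_a_r_cos[OF I.is_ideal, of f g]
    by (simp add: h a_minus_def)
  have carrier_Q: "carrier Q = range h"
    by (auto simp: Q FactRing_def A_RCOSETS_def' h)
  \<comment> \<open>Properness makes the quotient nontrivial, so that the image of the ground field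
    is a subfield.\<close>
  have "\<one>\<^bsub>Q\<^esub> \<noteq> \<zero>\<^bsub>Q\<^esub>"
    using h_eq[of 1 0] proper h.hom_one h.hom_zero by (simp add: T_def)
  moreover have K: "K = h ` range scalar"
    by (auto simp: K_def trunc_scalars_def T_def h_def)
  ultimately have field: "subfield K Q"
    using h.img_is_subfield(2)[OF subfield_scalars] by simp
  have K_h: "h (scalar c) \<in> K" for c
    by (simp add: K)
  have h_add: "h (f + g) = h f \<oplus>\<^bsub>Q\<^esub> h g" and h_mult: "h (f * g) = h f \<otimes>\<^bsub>Q\<^esub> h g" for f g
    using h.hom_add[of f g] h.hom_mult[of f g] by simp_all
  have h_0: "h 0 = \<zero>\<^bsub>Q\<^esub>"
    using h.hom_zero by simp
  obtain ws where ws: "set ws = {w :: 'x list. length w \<le> j}"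
    using finite_list[OF finite_short_words] by blast
  define Us where "Us = map (\<lambda>w. h (mon w)) ws"
  have Us: "set Us \<subseteq> carrier Q"
    by (auto simp: Us_def carrier_Q)
  have h_mon: "h (mon w) \<in> Q.Span K Us" for w
  proof (cases "length w \<le> j")
    case True
    then have "h (mon w) \<in> set Us"
      by (simp add: Us_def ws)
    then show ?thesis
      using Q.Span_base_incl[OF field Us] by blast
  next
    case False
    then have "h (mon w) = h 0"
      unfolding h_eq using mon_in_trunc_ideal[of j w F] by (simp add: T_def)
    then show ?thesis
      using Q.Span_subgroup_props(2)[OF field Us] by (simp add: h_0)
  qed
  have "h f \<in> Q.Span K Us" for f
  proof -
    have "h (\<Sum>w\<in>W. scalar (c w) * mon w) \<in> Q.Span K Us" if "finite W" for W and c :: "'x list \<Rightarrow> 'k"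
      using that
    proof (induction W rule: finite_induct)
      case empty
      show ?case
        using Q.Span_subgroup_props(2)[OF field Us] by (simp add: h_0)
    next
      case (insert w W)
      have "h (scalar (c w) * mon w) \<in> Q.Span K Us"
        unfolding h_mult by (rule Q.Span_smult_closed[OF field Us K_h h_mon])
      then show ?case
        using insert Q.Span_subgroup_props(3)[OF field Us] by (simp add: h_add)
    qed
    from this[OF finite_keys, of "Poly_Mapping.lookup f" f] show ?thesis
      by (simp only: expand_mon)
  qed
  then have "Q.Span K Us = carrier Q"
    using Q.Span_subgroup_props(1)[OF field Us] by (auto simp: carrier_Q)
  \<comment> \<open>Finite dimension comes first: it is what identifies \<open>trunc_dim\<close>
    with the length of an actual basis.\<close>
  then have "Q.finite_dimension K (carrier Q)"
    using Q.Span_finite_dimension[OF field Us] by simp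
  then obtain n where n: "Q.dimension n K (carrier Q)"
    by (auto simp: Q.finite_dimension_def)
  then have dim: "trunc_dim F j = n"
    using Q.dimI[OF field n] by (simp add: trunc_dim_def Q_def K_def over_def)
  obtain Vs where Vs: "set Vs \<subseteq> carrier Q" "length Vs = n" "Q.Span K Vs = carrier Q"
    using Q.exists_base[OF field n] by blast
  have "\<exists>bs. Vs = map h bs"
    using Vs(1) by (auto simp: carrier_Q ex_map_conv)
  then obtain bs where bs: "Vs = map h bs"
    by blast
  \<comment> \<open>Linear combinations in the quotient are lifted to the free algebra, up to an
    element of the ideal.\<close>
  have span: "\<exists>g \<in> fa.span (set cs). f - g \<in> T" if "h f \<in> Q.Span K (map h cs)" for f cs
    using that
  proof (induction cs arbitrary: f)
    case Nil
    then show ?case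
      using h_eq[of f 0] by (intro bexI[of _ 0]) (simp_all add: h_0 fa.span_zero)
  next
    case (Cons b cs)
    then obtain c q where q: "q \<in> Q.Span K (map h cs)" "h f = h (scalar c) \<otimes>\<^bsub>Q\<^esub> h b \<oplus>\<^bsub>Q\<^esub> q"
      by (auto simp: Q.line_extension_mem_iff K)
    have "set (map h cs) \<subseteq> carrier Q"
      by (auto simp: carrier_Q)
    then have "q \<in> carrier Q"
      using Q.Span_subgroup_props(1)[OF field] q(1) by blast
    then obtain g where g: "q = h g"
      by (auto simp: carrier_Q)
    obtain g' where g': "g' \<in> fa.span (set cs)" "g - g' \<in> T"
      using Cons.IH[of g] q(1) g by auto
    have "h f = h (scalar c * b + g)"
      using q(2) by (simp add: g h_add h_mult)
    then have "f - (scalar c * b + g) \<in> T"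
      by (simp only: h_eq)
    then have "(f - (scalar c * b + g)) + (g - g') \<in> T"
      using g'(2) I.a_closed by fastforce
    then have "f - (scalar c * b + g') \<in> T"
      by (simp add: algebra_simps)
    moreover have "g' \<in> fa.span (set (b # cs))"
      using g'(1) fa.span_mono[of "set cs" "set (b # cs)"] by auto
    then have "scalar c * b + g' \<in> fa.span (set (b # cs))"
      by (rule fa.span_add[rotated]) (simp add: fa.span_scale fa.span_base)
    ultimately show ?case
      by blast
  qed
  define D where "D = trunc j ` set bs \<union> B"
  have "trunc j f \<in> fa.span D" for f
  proof -
    have "h f \<in> Q.Span K (map h bs)"
      using Vs(3) by (simp add: bs carrier_Q)
    then obtain g where g: "g \<in> fa.span (set bs)" "f - g \<in> T"
      using span by blast
    have "trunc j g \<in> fa.span D"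
      using trunc_span[OF g(1)] fa.span_mono[of "trunc j ` set bs" D] by (auto simp: D_def)
    moreover have "trunc j (f - g) \<in> fa.span D"
      using B(2)[of "f - g"] g(2) fa.span_mono[of B D] by (auto simp: D_def T_def)
    ultimately have "trunc j (g + (f - g)) \<in> fa.span D"
      unfolding trunc_add by (rule fa.span_add)
    then show ?thesis
      by simp
  qed
  then have mon_D: "trunc j (mon w) \<in> fa.span D" for w .
  have sub: "mon ` {w :: 'x list. length w \<le> j} \<subseteq> fa.span D"
  proof safe
    fix w :: "'x list" assume "length w \<le> j"
    then show "mon w \<in> fa.span D"
      using mon_D[of w] by (simp add: trunc_mon)
  qed
  have inj: "inj (mon :: 'x list \<Rightarrow> ('x, 'k) free_alg)"
    by (auto simp: inj_on_def mon_def dest!: arg_cong[of _ _ Poly_Mapping.keys])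
  have "fa.independent (mon ` {w :: 'x list. length w \<le> j} :: ('x, 'k) free_alg set)"
  proof (rule fa.independent_if_scalars_zero)
    fix c :: "('x, 'k) free_alg \<Rightarrow> 'k" and x :: "('x, 'k) free_alg"
    assume 0: "(\<Sum>x\<in>mon ` {w :: 'x list. length w \<le> j}. scalar (c x) * x) = 0"
      and "x \<in> mon ` {w :: 'x list. length w \<le> j}"
    then obtain w where w: "x = mon w" "length w \<le> j"
      by auto
    have "0 = Poly_Mapping.lookup (\<Sum>x\<in>mon ` {w :: 'x list. length w \<le> j}. scalar (c x) * x) w"
      unfolding 0 by simp
    also have "\<dots> = (\<Sum>v | length v \<le> j. if w = v then c (mon v) else 0)"
      by (subst sum.reindex[OF inj_on_subset[OF inj]])
        (auto simp: lookup_sum lookup_scalar_mult lookup_mon intro!: sum.cong)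
    finally show "c x = 0"
      using w by (simp add: finite_short_words)
  qed (simp add: finite_short_words)
  moreover have "finite D"
    using B(1) by (simp add: D_def)
  ultimately have "card (mon ` {w :: 'x list. length w \<le> j} :: ('x, 'k) free_alg set) \<le> card D"
    using fa.independent_span_bound sub by blast
  moreover have "card (mon ` {w :: 'x list. length w \<le> j} :: ('x, 'k) free_alg set) = card {w :: 'x list. length w \<le> j}"
    by (rule card_image[OF inj_on_subset[OF inj]]) simp
  moreover have "card D \<le> n + card B"
  proof -
    have "card (trunc j ` set bs) \<le> n"
      using card_image_le[of "set bs" "trunc j"] card_length[of bs] Vs(2) by (simp add: bs)
    then show ?thesis
      unfolding D_def using card_Un_le[of "trunc j ` set bs" B] by simp
  qed
  ultimately show ?thesis
    by (simp add: dim)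
qed

text \<open>The constant coefficient vanishes on every generator: the relations start in positive
  degree, and words longer than \<open>j\<close> are nonempty.\<close>

lemma one_notin_trunc_ideal:
  fixes F :: "('x::finite, 'k::field) free_alg"
  assumes low: "\<And>w. length w < k \<Longrightarrow> Poly_Mapping.lookup F w = 0" and "3 \<le> k"
  shows "1 \<notin> trunc_ideal F j"
proof
  assume "1 \<in> trunc_ideal F j"
  then have "1 \<in> fa.span (range (rel_mult F) \<union> {mon w |w. length w > j})"
    using trunc_ideal_subset by (auto simp: ideal_span_def)
  moreover have "Poly_Mapping.lookup f [] = 0"
    if "f \<in> fa.span (range (rel_mult F) \<union> {mon w |w. length w > j})" for f
    using that
  proof (induction rule: fa.span_induct_alt)
    case (step c x y)
    have "Poly_Mapping.lookup (rel_mult F (u, i, v)) [] = 0" for u i v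
      unfolding lookup_rel_mult[of "[]" j, simplified] word_coeff_def
      using low[of "[i]"] \<open>3 \<le> k\<close> by (auto intro!: sum.neutral)
    then have "Poly_Mapping.lookup x [] = 0"
      using step(1) by (auto simp: lookup_mon)
    then show ?case
      using step by (simp add: lookup_add lookup_scalar_mult)
  qed simp
  ultimately have "Poly_Mapping.lookup (1 :: ('x, 'k) free_alg) [] = 0"
    by blast
  then show False
    by (simp add: lookup_one zero_list_def)
qed

text \<open>A basis of the truncated relations has at most as many elements as there are normal
  symbols. Comparing the two counts of words of length at most \<open>j\<close> leaves at least the
  normal words for the quotient.\<close>

lemma (in leading_words) trunc_dim_ge:
  fixes F :: "('x::finite, 'k::field) free_alg"
  assumes F: "F \<in> potentials_between k m"
  shows "(\<Sum>d\<le>j. card (normal_words d)) \<le> trunc_dim F j"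
proof -
  define \<phi> where "\<phi> x = trunc j (rel_mult F x)" for x
  let ?S = "symbols k j :: ('x list \<times> 'x \<times> 'x list) set"
  have low: "Poly_Mapping.lookup F w = 0" if "length w < k" for w
    using lookup_hom_comp[of w F] F that by (simp add: potentials_between_def)
  have cyc: "Poly_Mapping.lookup F (x # u) = Poly_Mapping.lookup F (u @ [x])" for x u
    using lookup_cyc_shift[of F u x] F by (simp add: potentials_between_def potentials_def)
  obtain B where B: "B \<subseteq> \<phi> ` ?S" "fa.independent B" "\<phi> ` ?S \<subseteq> fa.span B"
    using fa.maximal_independent_subset by blast
  \<comment> \<open>Indexing the basis injectively by symbols turns its independence into the
    hypothesis of \<open>card_independent_le\<close>.\<close>
  obtain V where V: "V \<subseteq> ?S" "inj_on \<phi> V" "B = \<phi> ` V"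
    using B(1) unfolding subset_image_inj by blast
  have finV: "finite V"
    using V(1) finite_symbols by (rule finite_subset)
  have "card V \<le> card (normal_symbols j)"
  proof (rule card_independent_le[OF cyc low V(1)])
    fix c v
    assume 0: "\<And>y. length y \<le> j \<Longrightarrow> (\<Sum>v\<in>V. c v * word_coeff (Poly_Mapping.lookup F) j v y) = 0"
      and v: "v \<in> V"
    have "(\<Sum>v\<in>V. scalar (c v) * \<phi> v) = 0"
    proof (rule poly_mapping_eqI)
      fix y
      show "Poly_Mapping.lookup (\<Sum>v\<in>V. scalar (c v) * \<phi> v) y = Poly_Mapping.lookup 0 y"
        using 0[of y] by (cases "length y \<le> j")
          (simp_all add: lookup_sum lookup_scalar_mult \<phi>_def lookup_trunc lookup_rel_mult)
    qed
    then have "(\<Sum>x\<in>B. scalar (c (inv_into V \<phi> x)) * x) = 0"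
      unfolding V(3) by (subst sum.reindex[OF V(2)]) (simp add: V(2))
    then have "c (inv_into V \<phi> (\<phi> v)) = 0"
      using fa.independentD[OF B(2), of B "\<lambda>x. c (inv_into V \<phi> x)" "\<phi> v"] finV v V(3) by simp
    then show "c v = 0"
      using V(2) v by simp
  qed
  moreover have "card B = card V"
    unfolding V(3) using V(2) by (rule card_image)
  moreover have "trunc j f \<in> fa.span B" if "f \<in> trunc_ideal F j" for f
  proof -
    have "trunc j f \<in> fa.span (\<phi> ` ?S)"
      unfolding \<phi>_def using trunc_ideal_span[OF low that k3] .
    then show ?thesis
      using fa.span_minimal[OF B(3) fa.subspace_span] by blast
  qed
  then have "card {w :: 'x list. length w \<le> j} \<le> trunc_dim F j + card B"
    using one_notin_trunc_ideal[OF low k3] finV V(3) by (intro card_short_words_le) auto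
  ultimately show ?thesis
    using card_normal_symbols_le[of j] by linarith
qed

theorem lemma1p3:
  fixes F :: "('x::finite, 'k::field) free_alg" and n k m :: nat
  assumes "n = CARD('x)" and "n \<ge> 2"
    and "m \<ge> k" and "k \<ge> 3" and "(n, k) \<noteq> (2, 3)"
    and "F \<in> potentials_between k m"
  shows "fps_coeff_le
    (inverse (1 - fps_X) *
     inverse (1 - of_nat n * fps_X + of_nat n * fps_X ^ (k - 1) - fps_X ^ k))
    (potential_series F)"
proof -
  obtain t b :: 'x and \<pi> where "leading_words t b \<pi> k"
  proof (cases "n = 2")
    case True
    then obtain t b :: 'x where "b \<noteq> t"
      using assms(1) card_2_iff'[of "UNIV :: 'x set"] by auto
    \<comment> \<open>With two letters the involution has to fix \<open>b\<close>; this is allowed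
      since then \<open>k \<noteq> 3\<close>.\<close>
    then have "leading_words t b id k"
      using assms True by unfold_locales auto
    then show thesis
      using that by blast
  next
    case False
    then obtain A :: "'x set" where "card A = 3"
      using assms(1,2) obtain_subset_with_card_n[of 3 "UNIV :: 'x set"] by auto
    then obtain t b c :: 'x where tbc: "t \<noteq> b" "b \<noteq> c" "t \<noteq> c"
      by (auto simp: card_3_iff)
    \<comment> \<open>With a third letter, the transposition of \<open>b\<close> and
      \<open>c\<close> moves \<open>b\<close>, so \<open>k = 3\<close> is covered too.\<close>
    have "leading_words t b (\<lambda>x. if x = b then c else if x = c then b else x) k"
      using assms(4) tbc by unfold_locales auto
    then show thesis
      using that by blast
  qed
  then interpret leading_words t b \<pi> k .
  show ?thesis
    unfolding fps_coeff_le_def assms(1) nth_hilbert_series potential_series_def fps_nth_Abs_fps of_nat_le_iff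
    using trunc_dim_ge[OF assms(6)] by blast
qed

end
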